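(* Let $w$ be a lower Christoffel word on $\{a,b\}$ and let $q(w)$ be the lower-left entry of its Cohn matrix $N(w)$. Then \[ L(B(w))=\sqrt{4-\frac{2}{q(w)^2}}. \]
   Context: Cohn matrices: $A=\begin{pmatrix}3&\sqrt2\\\sqrt2&1\end{pmatrix}$, $B=\begin{pmatrix}\sqrt2&1\\1&\sqrt2\end{pmatrix}$; for a finite word $w$ on $\{a,b\}$, $N(w)$ is obtained by replacing each $a$ by $A$, each $b$ by $B$, and multiplying in order. Digits and norms: $\mathscr{Q}=\{(x,y): x^2+y^2=1,\ x,y\ge0\}$, Romik's map $\mathcal{T}(x,y)=\left(\frac{|2-x-2y|}{3-2x-2y},\frac{|2-2x-y|}{3-2x-2y}\right)$, digit of $(x,y)$ equal to $1$ if $4/5\le x\le1$, $2$ if $3/5\le x\le4/5$, $3$ if $0\le x\le3/5$ (boundary points admit both adjacent digits). Every $P\in\{1,2,3\}^{\mathbb{N}}$ is the digit expansion of exactly one point $(\alpha,\beta)\in\mathscr{Q}$, and $\|P\|=\frac{1+\beta-\alpha}{\sqrt2\,\alpha}\in[0,\infty]$. Words: for a word $W$ on $\{a,b,a^\vee\}$, $W^*$ is its reverse and $W^\vee$ exchanges $a$ and $a^\vee$ (fixing $b$). For finite $w$ on $\{a,b\}$, $w^*$ is its reverse and $w^\infty=www\cdots$. For $E=l_1l_2\cdots$ on $\{a,b\}$, $\jmath(E)=l_1'l_2'\cdots$ with $l_k'=b$ if $l_k=b$, and if $l_k=a$, $l_k'=a$ or $a^\vee$ according as the number of $b$'s among $l_1,\dots,l_{k-1}$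 is even or odd. $E(w)=\jmath(w^\infty)$. $\Pi$ is the substitution $a\mapsto31$, $b\mapsto2$, $a^\vee\mapsto13$. A doubly infinite word is an element of $\{a,b,a^\vee\}^{\mathbb{Z}}$ up to shift; a section $E^*|F$ is a choice of base point so it reads $\cdots e_2e_1f_1f_2\cdots$. $B(w)$ is the doubly infinite word with section $E(w^* )^*|E(w)$. $L(E^*|F)=(\|\Pi(E^\vee)\|+\|\Pi(F)\|)/\sqrt2$; $L(B)=\sup\max\{L(E^*|F),L((E^\vee)^*|F^\vee)\}$ over all sections of $B$. Christoffel words: for coprime positive integers $s,t$, the lower Christoffel word of slope $t/s$ encodes the lattice path from $(0,0)$ to $(s,t)$ with horizontal unit steps $a$ and vertical unit steps $b$ lying below the segment from $(0,0)$ to $(s,t)$ with no lattice point strictly between path and segment; $a$ and $b$ are the trivial lower Christoffel words (slopes $0$ and $\infty$). *)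

theory Defs
  imports "HOL-Analysis.Analysis" "HOL-Library.Stream"
begin

text \<open>
  The alphabet \<open>{a, b}\<close> of Christoffel words and the alphabet \<open>{a, b, a\<^sup>\<or>}\<close> are
  separate types.  Finite words are lists, one-sided infinite words are streams; the reversal
  \<open>w\<^sup>*\<close> of a finite word is \<^const>\<open>rev\<close>, and \<open>w\<^sup>\<infinity>\<close> is \<^const>\<open>cycle\<close>.
\<close>

datatype ab = La | Lb

datatype letter = Ma | Mb | Mav

primrec vee_letter :: "letter \<Rightarrow> letter" where
  "vee_letter Ma = Mav"
| "vee_letter Mb = Mb"
| "vee_letter Mav = Ma"

definition vee :: "letter stream \<Rightarrow> letter stream" where
  "vee E = smap vee_letter E"

definition jmath :: "ab stream \<Rightarrow> letter stream" where
  "jmath E = smap (\<lambda>k. case E !! k of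
       Lb \<Rightarrow> Mb
     | La \<Rightarrow> if even (count_list (stake k E) Lb) then Ma else Mav) nats"

definition E_word :: "ab list \<Rightarrow> letter stream" where
  "E_word w = jmath (cycle w)"

primrec cohn_letter :: "ab \<Rightarrow> real^2^2" where
  "cohn_letter La = vector [vector [3, sqrt 2], vector [sqrt 2, 1]]"
| "cohn_letter Lb = vector [vector [sqrt 2, 1], vector [1, sqrt 2]]"

primrec cohn :: "ab list \<Rightarrow> real^2^2" where
  "cohn [] = mat 1"
| "cohn (l # w) = cohn_letter l ** cohn w"

definition cohn_q :: "ab list \<Rightarrow> real" where
  "cohn_q w = cohn w $ 2 $ 1"

definition path_point :: "ab list \<Rightarrow> nat \<Rightarrow> nat \<times> nat" where
  "path_point w k = (count_list (take k w) La, count_list (take k w) Lb)"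

definition path_points :: "ab list \<Rightarrow> (nat \<times> nat) set" where
  "path_points w = path_point w ` {..length w}"

text \<open>
  A lattice point \<open>(i, j)\<close> lies on or below the segment from \<open>(0, 0)\<close> to \<open>(s, t)\<close> iff
  \<open>i \<le> s\<close> and \<open>s * j \<le> t * i\<close>.  By convexity the whole path lies below the segment as soon as its
  lattice points do.  Since the steps are unit steps, the lattice points of the path are exactly
  \<open>path_points\<close>, and \<open>(i, j)\<close> is strictly above the path iff it is strictly higher than every
  \<open>(i, y)\<close> on the path.
\<close>

definition strictly_between :: "nat \<Rightarrow> nat \<Rightarrow> ab list \<Rightarrow> nat \<times> nat \<Rightarrow> bool" where
  "strictly_between s t w = (\<lambda>(i, j).
     i \<le> s \<and> s * j < t * i \<and> (\<forall>y. (i, y) \<in> path_points w \<longrightarrow> y < j))"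

definition lower_christoffel_of_slope :: "nat \<Rightarrow> nat \<Rightarrow> ab list \<Rightarrow> bool" where
  "lower_christoffel_of_slope s t w \<longleftrightarrow>
     path_point w (length w) = (s, t) \<and>
     (\<forall>(i, j) \<in> path_points w. s * j \<le> t * i) \<and>
     (\<nexists>p. strictly_between s t w p)"

definition lower_christoffel :: "ab list \<Rightarrow> bool" where
  "lower_christoffel w \<longleftrightarrow>
     w = [La] \<or> w = [Lb] \<or>
     (\<exists>s t. 0 < s \<and> 0 < t \<and> coprime s t \<and> lower_christoffel_of_slope s t w)"

definition quarter_circle :: "(real \<times> real) set" where
  "quarter_circle = {(x, y). x\<^sup>2 + y\<^sup>2 = 1 \<and> 0 \<le> x \<and> 0 \<le> y}"

definition romik :: "real \<times> real \<Rightarrow> real \<times> real" where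
  "romik = (\<lambda>(x, y).
     (\<bar>2 - x - 2 * y\<bar> / (3 - 2 * x - 2 * y), \<bar>2 - 2 * x - y\<bar> / (3 - 2 * x - 2 * y)))"

datatype digit = D1 | D2 | D3

text \<open>A relation, because boundary points admit both adjacent digits.\<close>

primrec has_digit :: "digit \<Rightarrow> real \<times> real \<Rightarrow> bool" where
  "has_digit D1 p \<longleftrightarrow> 4/5 \<le> fst p \<and> fst p \<le> 1"
| "has_digit D2 p \<longleftrightarrow> 3/5 \<le> fst p \<and> fst p \<le> 4/5"
| "has_digit D3 p \<longleftrightarrow> 0 \<le> fst p \<and> fst p \<le> 3/5"

definition digit_expansion :: "digit stream \<Rightarrow> real \<times> real \<Rightarrow> bool" where
  "digit_expansion P p \<longleftrightarrow> (\<forall>n. has_digit (P !! n) ((romik ^^ n) p))"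

definition romik_point :: "digit stream \<Rightarrow> real \<times> real" where
  "romik_point P = (THE p. p \<in> quarter_circle \<and> digit_expansion P p)"

text \<open>
  The value is \<open>\<infinity>\<close> exactly at the point \<open>(0, 1)\<close>, in accordance with the convention
  \<open>2 / 0 = \<infinity>\<close> for the division of extended reals.
\<close>

definition romik_norm :: "digit stream \<Rightarrow> ereal" where
  "romik_norm P = (let (\<alpha>, \<beta>) = romik_point P in ereal (1 + \<beta> - \<alpha>) / ereal (sqrt 2 * \<alpha>))"

primrec Pi_letter :: "letter \<Rightarrow> digit list" where
  "Pi_letter Ma = [D3, D1]"
| "Pi_letter Mb = [D2]"
| "Pi_letter Mav = [D1, D3]"

definition Pi_word :: "letter stream \<Rightarrow> digit stream" where
  "Pi_word E = flat (smap Pi_letter E)"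

definition shift_equiv :: "(int \<Rightarrow> letter) \<Rightarrow> (int \<Rightarrow> letter) \<Rightarrow> bool" where
  "shift_equiv f g \<longleftrightarrow> (\<exists>n. \<forall>k. g k = f (k + n))"

lemma equivp_shift_equiv: "equivp shift_equiv"
proof (rule equivpI)
  show "reflp shift_equiv"
    unfolding reflp_def shift_equiv_def by (auto intro: exI[of _ 0])
  show "symp shift_equiv"
  proof (rule sympI)
    fix f g assume "shift_equiv f g"
    then obtain n where "\<And>k. g k = f (k + n)" unfolding shift_equiv_def by blast
    then show "shift_equiv g f"
      unfolding shift_equiv_def by (auto intro!: exI[of _ "- n"])
  qed
  show "transp shift_equiv"
  proof (rule transpI)
    fix f g h assume "shift_equiv f g" "shift_equiv g h"
    then obtain m n where "\<And>k. g k = f (k + m)" "\<And>k. h k = g (k + n)"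
      unfolding shift_equiv_def by blast
    then show "shift_equiv f h"
      unfolding shift_equiv_def by (auto intro!: exI[of _ "n + m"] simp: add.assoc)
  qed
qed

quotient_type biword = "int \<Rightarrow> letter" / shift_equiv
  by (rule equivp_shift_equiv)

text \<open>
  A 
  to left, starting at the base point.
\<close>

definition join :: "letter stream \<Rightarrow> letter stream \<Rightarrow> int \<Rightarrow> letter" where
  "join E F k = (if k < 0 then E !! nat (- k - 1) else F !! nat k)"

definition sections :: "biword \<Rightarrow> (letter stream \<times> letter stream) set" where
  "sections W = {(E, F). abs_biword (join E F) = W}"

definition B_word :: "ab list \<Rightarrow> biword" where
  "B_word w = abs_biword (join (E_word (rev w)) (E_word w))"

definition L_section :: "letter stream \<Rightarrow> letter stream \<Rightarrow> ereal" where
  "L_section E F = (romik_norm (Pi_word (vee E)) + romik_norm (Pi_word F)) / ereal (sqrt 2)"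

definition L_biword :: "biword \<Rightarrow> ereal" where
  "L_biword W = (SUP (E, F) \<in> sections W. max (L_section E F) (L_section (vee E) (vee F)))"

end

theory Submission
  imports Defs
begin

text \<open>
  In the coordinate \<open>x = \<parallel>P\<parallel>\<close> on the quarter circle the inverse branches of Romik's map are
  Moebius maps, and \<open>\<Pi>\<close> turns the letters \<open>a\<close>, \<open>b\<close> into the actions of the Cohn matrices \<open>A\<close>, \<open>B\<close>, while
  \<open>\<or>\<close> becomes \<open>x \<mapsto> 1 / x\<close>.  Hence every section of \<open>B(w)\<close> contributes
  \<open>1 / \<xi>(left) + \<xi>(right)\<close> and \<open>\<xi>(left) + 1 / \<xi>(right)\<close> (over \<open>\<surd>2\<close>), where left and right are
  read off the bi-infinite periodic word \<open>\<dots>www\<dots>\<close> and \<open>\<xi>\<close> is the limit of the products of Cohn matrices.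

  Both matrices are increasing and \<open>A\<close> takes larger values than \<open>B\<close>, so \<open>\<xi>\<close> decreases when the numbers of
  \<open>b\<close>'s in all prefixes grow.  In a Christoffel word the prefix of length \<open>k\<close> contains
  \<open>\<lfloor>k t / (s + t)\<rfloor>\<close> letters \<open>b\<close>; superadditivity of the floor shows that among all words read
  from the periodic word in either direction, \<open>w\<^sup>\<infinity>\<close> has the fewest and \<open>(w\<^sup>*)\<^sup>\<infinity>\<close> the most \<open>b\<close>'s in each
  prefix.  So the supremum is attained at the section defining \<open>B(w)\<close>, and equals
  \<open>\<surd>(tr\<^sup>2 - 4) / (\<surd>2 q)\<close> by the quadratic fixed point equation.  Finally \<open>w = a p b\<close> with a palindrome
  \<open>p\<close> forces \<open>tr = 2 \<surd>2 q\<close>.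
\<close>

subsection \<open>The action of the digits on the quarter circle\<close>

text \<open>Inverse of the coordinate defining \<open>romik_norm\<close>: a rational parametrization
  of the arc without (0, 1), the point whose coordinate would be infinite.\<close>

definition circle_pt :: "real \<Rightarrow> real \<times> real" where
  "circle_pt x = ((1 + sqrt 2 * x) / (1 + sqrt 2 * x + x\<^sup>2), (x\<^sup>2 + sqrt 2 * x) / (1 + sqrt 2 * x + x\<^sup>2))"

text \<open>The inverse branches of \<open>romik\<close> in this coordinate. Their images are
  separated by 1 / sqrt 2 and sqrt 2, the coordinates of the points with abscissa 4/5 and
  3/5.\<close>

primrec digit_act :: "digit \<Rightarrow> real \<Rightarrow> real" where
  "digit_act D1 x = x / (sqrt 2 * x + 1)"
| "digit_act D2 x = (x + sqrt 2) / (sqrt 2 * x + 1)"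
| "digit_act D3 x = x + sqrt 2"

lemma circle_pt_denom: "0 \<le> x \<Longrightarrow> 0 < 1 + sqrt 2 * x + x\<^sup>2"
  by (smt (verit) mult_nonneg_nonneg real_sqrt_ge_zero zero_le_power2)

lemma circle_pt_in_quarter_circle:
  assumes "0 \<le> x"
  shows "circle_pt x \<in> quarter_circle"
proof -
  define s where "s = sqrt (2::real)"
  have s: "s * s = 2" "0 \<le> s" unfolding s_def by simp_all
  have ss: "s * (s * z) = 2 * z" for z using s(1) by (simp add: mult.assoc[symmetric])
  have D: "0 < 1 + s * x + x\<^sup>2" using circle_pt_denom[OF assms] unfolding s_def .
  have "(1 + s * x)\<^sup>2 + (x\<^sup>2 + s * x)\<^sup>2 = (1 + s * x + x\<^sup>2)\<^sup>2"
    using s(1) ss by (simp add: power2_eq_square algebra_simps)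
  moreover have "0 \<le> s * x" using s assms by simp
  ultimately show ?thesis using D
    unfolding circle_pt_def quarter_circle_def s_def[symmetric]
    by (simp add: power_divide add_divide_distrib[symmetric])
qed

lemma quarter_circle_pt:
  assumes "p \<in> quarter_circle" "0 < fst p"
  obtains x where "0 \<le> x" "p = circle_pt x"
proof -
  define s where "s = sqrt (2::real)"
  have s: "s\<^sup>2 = 2" "0 < s" unfolding s_def by simp_all
  obtain a b where p: "p = (a, b)" by (cases p)
  have ab: "a\<^sup>2 + b\<^sup>2 = 1" "0 < a" "0 \<le> b" using assms unfolding p quarter_circle_def by auto
  have a1: "a \<le> 1" using ab by (smt (verit) power2_le_imp_le one_power2 zero_le_power2)
  define x where "x = (1 + b - a) / (s * a)"
  have x0: "0 \<le> x" unfolding x_def using ab a1 s by simp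
  have sx: "s * x = (1 + b - a) / a" unfolding x_def using s ab by simp
  have "2 * a\<^sup>2 * x\<^sup>2 = (s * a * x)\<^sup>2" using s by (simp add: power_mult_distrib)
  also have "s * a * x = 1 + b - a" unfolding x_def using s ab by simp
  also have "(1 + b - a)\<^sup>2 = 2 * ((1 - a) * (1 + b))" using ab(1) by algebra
  finally have x2: "x\<^sup>2 = (1 - a) * (1 + b) / a\<^sup>2" using ab by (simp add: field_simps)
  have D: "1 + s * x + x\<^sup>2 = (1 + b) / a\<^sup>2"
    unfolding sx x2 using ab(2) by (simp add: field_simps power2_eq_square)
  have "1 + s * x = (1 + b) / a" unfolding sx using ab(2) by (simp add: field_simps)
  then have 1: "(1 + s * x) / (1 + s * x + x\<^sup>2) = a"
    unfolding D using ab by (simp add: power2_eq_square)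
  have "x\<^sup>2 + s * x = (1 + b) / a\<^sup>2 - 1" using D by simp
  also have "\<dots> = (1 + b - a\<^sup>2) / a\<^sup>2" using ab by (simp add: field_simps)
  also have "1 + b - a\<^sup>2 = b * (1 + b)" using ab(1) by algebra
  finally have 2: "(x\<^sup>2 + s * x) / (1 + s * x + x\<^sup>2) = b"
    unfolding D using ab by simp
  have "p = circle_pt x" unfolding circle_pt_def p using 1 2 s_def by simp
  then show ?thesis using that x0 by blast
qed

lemma circle_pt_norm:
  assumes "0 \<le> x"
  shows "(1 + snd (circle_pt x) - fst (circle_pt x)) / (sqrt 2 * fst (circle_pt x)) = x"
proof -
  define s where "s = sqrt (2::real)"
  have s: "s * s = 2" "0 < s" unfolding s_def by simp_all
  have ss: "s * (s * z) = 2 * z" for z using s(1) by (simp add: mult.assoc[symmetric])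
  define D where "D = 1 + s * x + x\<^sup>2"
  have D: "0 < D" using circle_pt_denom[OF assms] unfolding s_def D_def .
  have pos: "0 < 1 + s * x" using s assms by (smt (verit) mult_nonneg_nonneg)
  have "D + (x\<^sup>2 + s * x) - (1 + s * x) = x * (s * (1 + s * x))"
    unfolding D_def using ss by (simp add: algebra_simps power2_eq_square)
  moreover have "1 + (x\<^sup>2 + s * x) / D - (1 + s * x) / D = (D + (x\<^sup>2 + s * x) - (1 + s * x)) / D"
    using D by (simp add: add_divide_distrib diff_divide_distrib)
  ultimately have "1 + (x\<^sup>2 + s * x) / D - (1 + s * x) / D = (x * (s * (1 + s * x))) / D"
    by simp
  then show ?thesis
    unfolding circle_pt_def s_def[symmetric] D_def[symmetric] using D pos s by simp
qed

text \<open>Reflecting the circle in the diagonal inverts the coordinate; through this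
  \<open>vee\<close> acts as x \<mapsto> 1 / x.\<close>

lemma prod_swap_circle_pt:
  assumes "0 < x"
  shows "prod.swap (circle_pt x) = circle_pt (1 / x)"
proof -
  have D: "0 < 1 + sqrt 2 * x + x\<^sup>2" using circle_pt_denom assms by simp
  have "1 + sqrt 2 * (1 / x) + (1 / x)\<^sup>2 = (1 + sqrt 2 * x + x\<^sup>2) / x\<^sup>2"
    using assms by (simp add: field_simps power2_eq_square)
  moreover have "1 + sqrt 2 * (1 / x) = (x\<^sup>2 + sqrt 2 * x) / x\<^sup>2"
    "(1 / x)\<^sup>2 + sqrt 2 * (1 / x) = (1 + sqrt 2 * x) / x\<^sup>2"
    using assms by (simp_all add: field_simps power2_eq_square)
  ultimately show ?thesis using D assms unfolding circle_pt_def by simp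
qed

lemma romik_fraction:
  assumes D: "(0::real) < D" and K: "0 < K" and a: "0 \<le> a" and b: "0 \<le> b"
    and x: "x = X / D" and y: "y = Y / D"
    and h1: "\<bar>2 * D - X - 2 * Y\<bar> = a" and h2: "\<bar>2 * D - 2 * X - Y\<bar> = b"
    and h3: "3 * D - 2 * X - 2 * Y = K"
  shows "romik (x, y) = (a / K, b / K)"
proof -
  have "2 - x - 2 * y = (2 * D - X - 2 * Y) / D" "2 - 2 * x - y = (2 * D - 2 * X - Y) / D"
    "3 - 2 * x - 2 * y = K / D"
    unfolding x y h3[symmetric] using D by (simp_all add: field_simps)
  then show ?thesis unfolding romik_def using D K h1 h2 by (simp add: abs_divide)
qed

lemma digit_act_nonneg: "0 \<le> x \<Longrightarrow> 0 \<le> digit_act d x"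
  by (cases d) simp_all

lemma circle_pt_digit_act:
  assumes "0 \<le> x"
  shows "has_digit d (circle_pt (digit_act d x)) \<and> romik (circle_pt (digit_act d x)) = circle_pt x"
proof -
  define s where "s = sqrt (2::real)"
  have s: "s * s = 2" "0 < s" unfolding s_def by simp_all
  have ss: "s * (s * z) = 2 * z" for z using s(1) by (simp add: mult.assoc[symmetric])
  define K where "K = 1 + s * x + x\<^sup>2"
  have K: "0 < K" using circle_pt_denom[OF assms] unfolding s_def K_def .
  have sx: "0 \<le> s * x" using s assms by simp
  define e where "e = s * x + 1"
  have e: "0 < e" using sx e_def by simp
  define N where "N = (case d of D1 \<Rightarrow> x | D2 \<Rightarrow> x + s | D3 \<Rightarrow> x + s)"
  define F where "F = (case d of D1 \<Rightarrow> e | D2 \<Rightarrow> e | D3 \<Rightarrow> 1)"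
  have F: "0 < F" unfolding F_def using e by (cases d) auto
  have N: "0 \<le> N" unfolding N_def using assms s by (cases d) auto
  have act: "digit_act d x = N / F"
    unfolding N_def F_def e_def s_def by (cases d) simp_all
  define D where "D = F\<^sup>2 + s * N * F + N\<^sup>2"
  have D: "0 < D" unfolding D_def using F N s by (smt (verit) mult_nonneg_nonneg zero_le_power2 zero_less_power)
  have DD: "1 + s * (N / F) + (N / F)\<^sup>2 = D / F\<^sup>2"
    "1 + s * (N / F) = (F\<^sup>2 + s * N * F) / F\<^sup>2"
    "(N / F)\<^sup>2 + s * (N / F) = (N\<^sup>2 + s * N * F) / F\<^sup>2"
    unfolding D_def using F by (simp_all add: add_divide_distrib power2_eq_square)
  define X where "X = F\<^sup>2 + s * N * F"
  define Y where "Y = N\<^sup>2 + s * N * F"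
  have pt: "circle_pt (digit_act d x) = (X / D, Y / D)"
    unfolding act circle_pt_def s_def[symmetric] DD(1) unfolding DD X_def Y_def using F by simp
  have h3: "3 * D - 2 * X - 2 * Y = K"
    unfolding D_def X_def Y_def K_def N_def F_def e_def
    using s(1) ss by (cases d) (simp_all add: algebra_simps power2_eq_square)
  \<comment> \<open>The signs of these two linear forms are constant on the arc of each digit, so
    the absolute values in \<open>romik\<close> yield the same point for all three.\<close>
  have h1: "2 * D - X - 2 * Y = (case d of D1 \<Rightarrow> 1 | _ \<Rightarrow> -1) * (1 + s * x)"
    unfolding D_def X_def Y_def K_def N_def F_def e_def
    using s(1) ss by (cases d) (simp_all add: algebra_simps power2_eq_square)
  have h2: "2 * D - 2 * X - Y = (case d of D3 \<Rightarrow> 1 | _ \<Rightarrow> -1) * (x\<^sup>2 + s * x)"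
    unfolding D_def X_def Y_def K_def N_def F_def e_def
    using s(1) ss by (cases d) (simp_all add: algebra_simps power2_eq_square)
  have r: "romik (X / D, Y / D) = ((1 + s * x) / K, (x\<^sup>2 + s * x) / K)"
  proof (rule romik_fraction[OF D K _ _ refl refl _ _ h3])
    show "\<bar>2 * D - X - 2 * Y\<bar> = 1 + s * x" using h1 sx by (cases d) (auto simp: abs_if)
    show "\<bar>2 * D - 2 * X - Y\<bar> = x\<^sup>2 + s * x" using h2 sx
      by (cases d) (auto simp: abs_if add_nonneg_nonneg not_less; smt (verit) zero_le_power2)+
  qed (use sx in simp_all)
  have h4: "D - X = N\<^sup>2" unfolding D_def X_def by simp
  \<comment> \<open>The abscissa X / D is compared with the digit boundaries 4/5 and 3/5.\<close>
  have h5: "case d of D1 \<Rightarrow> 5 * X - 4 * D = 3 * (s * x) + 1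
      | D2 \<Rightarrow> 5 * X - 3 * D = 5 * x\<^sup>2 + 4 * (s * x) \<and> 4 * D - 5 * X = 3 * (s * x) + 5
      | D3 \<Rightarrow> 3 * D - 5 * X = 3 * x\<^sup>2 + 4 * (s * x)"
    unfolding D_def X_def N_def F_def e_def using s(1) ss
    by (cases d) (simp_all add: algebra_simps power2_eq_square)
  have X0: "0 \<le> X" unfolding X_def using N F s by simp
  have "case d of D1 \<Rightarrow> 4 * D \<le> 5 * X | D2 \<Rightarrow> 3 * D \<le> 5 * X \<and> 5 * X \<le> 4 * D | D3 \<Rightarrow> 5 * X \<le> 3 * D"
    using h5 sx by (cases d) (simp_all, (smt (verit) zero_le_power2)+)
  moreover have "X \<le> D" using h4 by (smt (verit) zero_le_power2)
  ultimately have "has_digit d (X / D, Y / D)"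
    using D X0 by (cases d) (simp_all add: field_simps)
  then show ?thesis using pt r unfolding circle_pt_def K_def s_def by simp
qed

section \<open>Reflection in the diagonal\<close>

lemma quarter_circle_4_5:
  assumes "(a, b) \<in> quarter_circle"
  shows "4/5 \<le> b \<longleftrightarrow> a \<le> 3/5" "b \<le> 4/5 \<longleftrightarrow> 3/5 \<le> a"
proof -
  have h: "a\<^sup>2 + b\<^sup>2 = 1" "0 \<le> a" "0 \<le> b" using assms unfolding quarter_circle_def by auto
  have e: "(3/5)\<^sup>2 + (4/5)\<^sup>2 = (1::real)" by (simp add: power2_eq_square)
  have "4/5 \<le> b \<longleftrightarrow> (4/5)\<^sup>2 \<le> b\<^sup>2" using h(3) by (simp add: abs_le_square_iff[symmetric])
  also have "\<dots> \<longleftrightarrow> a\<^sup>2 \<le> (3/5)\<^sup>2" using h(1) e by linarith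
  also have "\<dots> \<longleftrightarrow> a \<le> 3/5" using h(2) by (simp add: abs_le_square_iff[symmetric])
  finally show "4/5 \<le> b \<longleftrightarrow> a \<le> 3/5" .
  have "b \<le> 4/5 \<longleftrightarrow> b\<^sup>2 \<le> (4/5)\<^sup>2" using h(3) by (simp add: abs_le_square_iff[symmetric])
  also have "\<dots> \<longleftrightarrow> (3/5)\<^sup>2 \<le> a\<^sup>2" using h(1) e by linarith
  also have "\<dots> \<longleftrightarrow> 3/5 \<le> a" using h(2) by (simp add: abs_le_square_iff[symmetric])
  finally show "b \<le> 4/5 \<longleftrightarrow> 3/5 \<le> a" .
qed

lemma quarter_circle_le_1:
  assumes "(a, b) \<in> quarter_circle" shows "a \<le> 1" "b \<le> 1"
proof -
  have h: "a\<^sup>2 + b\<^sup>2 = 1" using assms unfolding quarter_circle_def by auto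
  have "a\<^sup>2 \<le> 1\<^sup>2" "b\<^sup>2 \<le> 1\<^sup>2" 
    using h zero_le_power2[of a] zero_le_power2[of b] unfolding one_power2 by linarith+
  then show "a \<le> 1" "b \<le> 1" using power2_le_imp_le[of _ 1] by simp_all
qed

lemma swap_in_quarter_circle [simp]: "prod.swap p \<in> quarter_circle \<longleftrightarrow> p \<in> quarter_circle"
  unfolding quarter_circle_def by (cases p) (auto simp: add.commute)

lemma romik_swap: "romik (prod.swap p) = prod.swap (romik p)"
  unfolding romik_def by (cases p) (simp add: algebra_simps)

primrec swap_digit :: "digit \<Rightarrow> digit" where
  "swap_digit D1 = D3"
| "swap_digit D2 = D2"
| "swap_digit D3 = D1"

text \<open>The boundary points (4/5, 3/5) and (3/5, 4/5) are mirror images, so the reflection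
  exchanges the closed arcs of digits 1 and 3 and preserves that of digit 2.\<close>

lemma has_digit_swap:
  assumes "p \<in> quarter_circle"
  shows "has_digit (swap_digit d) (prod.swap p) \<longleftrightarrow> has_digit d p"
proof -
  obtain a b where p: "p = (a, b)" by (cases p)
  have q: "(a, b) \<in> quarter_circle" "(b, a) \<in> quarter_circle"
    using assms swap_in_quarter_circle[of p] unfolding p by simp_all
  have "0 \<le> a" "0 \<le> b" using q unfolding quarter_circle_def by auto
  then show ?thesis unfolding p
    using quarter_circle_4_5[OF q(1)] quarter_circle_4_5[OF q(2)] quarter_circle_le_1[OF q(1)]
    by (cases d) auto
qed

lemma romik_in_quarter_circle:
  assumes "p \<in> quarter_circle" shows "romik p \<in> quarter_circle"
proof -
  obtain a b where p: "p = (a, b)" by (cases p)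
  have h: "a\<^sup>2 + b\<^sup>2 = 1" using assms unfolding quarter_circle_def p by auto
  define D where "D = 3 - 2 * a - 2 * b"
  \<comment> \<open>On the circle a + b is at most sqrt 2 < 3/2, which makes the denominator
    positive.\<close>
  have "(a + b)\<^sup>2 = 2 * (a\<^sup>2 + b\<^sup>2) - (a - b)\<^sup>2" by (simp add: power2_eq_square algebra_simps)
  then have "(a + b)\<^sup>2 \<le> 2" using h by (smt (verit) zero_le_power2)
  then have "(a + b)\<^sup>2 < (3/2)\<^sup>2" by (simp add: power2_eq_square)
  then have "a + b < 3/2" by (rule power2_less_imp_less) simp
  then have D: "0 < D" unfolding D_def by simp
  have "(2 - a - 2 * b)\<^sup>2 + (2 - 2 * a - b)\<^sup>2 = D\<^sup>2 + (a\<^sup>2 + b\<^sup>2 - 1)"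
    unfolding D_def by (simp add: power2_eq_square algebra_simps)
  then have "(2 - a - 2 * b)\<^sup>2 + (2 - 2 * a - b)\<^sup>2 = D\<^sup>2" using h by simp
  moreover have "romik p = (\<bar>2 - a - 2 * b\<bar> / D, \<bar>2 - 2 * a - b\<bar> / D)"
    unfolding p romik_def D_def by simp
  ultimately show ?thesis using D unfolding quarter_circle_def
    by (simp add: power_divide add_divide_distrib[symmetric])
qed

lemma romik_funpow_in_quarter_circle:
  "p \<in> quarter_circle \<Longrightarrow> (romik ^^ n) p \<in> quarter_circle"
  by (induction n) (auto intro: romik_in_quarter_circle)

section \<open>Digit expansions and inverse branches of Romik's map\<close>

lemma digit_expansion_SCons:
  "digit_expansion (d ## P) p \<longleftrightarrow> has_digit d p \<and> digit_expansion P (romik p)"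
proof
  assume h: "digit_expansion (d ## P) p"
  have "has_digit (P !! n) ((romik ^^ n) (romik p))" for n
    using h[unfolded digit_expansion_def, rule_format, of "Suc n"] by (simp add: funpow_swap1)
  moreover have "has_digit d p"
    using h[unfolded digit_expansion_def, rule_format, of 0] by simp
  ultimately show "has_digit d p \<and> digit_expansion P (romik p)"
    unfolding digit_expansion_def by blast
next
  assume h: "has_digit d p \<and> digit_expansion P (romik p)"
  show "digit_expansion (d ## P) p"
    unfolding digit_expansion_def
  proof
    fix n show "has_digit ((d ## P) !! n) ((romik ^^ n) p)"
      using h by (cases n) (auto simp: digit_expansion_def funpow_swap1)
  qed
qed

lemma digit_expansion_swap:
  assumes "p \<in> quarter_circle"
  shows "digit_expansion (smap swap_digit P) (prod.swap p) \<longleftrightarrow> digit_expansion P p"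
proof -
  have "(romik ^^ n) (prod.swap p) = prod.swap ((romik ^^ n) p)" for n
    by (induction n) (simp_all add: romik_swap)
  then show ?thesis unfolding digit_expansion_def
    using has_digit_swap[OF romik_funpow_in_quarter_circle[OF assms]] by simp
qed

text \<open>The point (0, 1) is fixed by \<open>romik\<close> and lies in the arc of digit 3
  only.\<close>

lemma digit_expansion_0_1:
  assumes "digit_expansion P (0, 1)" shows "P !! n = D3"
proof -
  have "(romik ^^ k) (0, 1) = (0, 1)" for k
    by (induction k) (simp_all add: romik_def)
  then have "has_digit (P !! n) (0, 1)" using assms unfolding digit_expansion_def by metis
  then show ?thesis by (cases "P !! n") auto
qed

text \<open>Converse of \<open>circle_pt_digit_act\<close>. The condition on \<open>romik p\<close>
  excludes the preimages of (0, 1), for which x would be infinite.\<close>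

lemma romik_inverse_branch:
  assumes p: "p \<in> quarter_circle" and d: "has_digit d p" and pos: "0 < fst (romik p)"
  obtains x where "0 \<le> x" "p = circle_pt (digit_act d x)" "romik p = circle_pt x"
proof -
  obtain x where x: "0 \<le> x" "romik p = circle_pt x"
    using quarter_circle_pt[OF romik_in_quarter_circle[OF p] pos] by blast
  have 1: "0 < fst p"
  proof (rule ccontr)
    assume "\<not> 0 < fst p"
    then have "p = (0, 1)" using p unfolding quarter_circle_def
      by (cases p) (auto simp: power2_eq_1_iff)
    then show False using pos by (simp add: romik_def)
  qed
  obtain y where y: "0 \<le> y" "p = circle_pt y" using quarter_circle_pt[OF p 1] by blast
  define s where "s = sqrt (2::real)"
  have s: "s * s = 2" "0 < s" unfolding s_def by simp_all
  have ss: "s * (s * z) = 2 * z" for z using s(1) by (simp add: mult.assoc[symmetric])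
  define D where "D = 1 + s * y + y\<^sup>2"
  have D: "0 < D" using circle_pt_denom[OF y(1)] unfolding D_def s_def .
  have f: "fst p = (1 + s * y) / D" unfolding y circle_pt_def D_def s_def by simp
  \<comment> \<open>Comparing the abscissa with 4/5 or 3/5 is a quadratic inequality in y; it
    factors with root s * y = 1 or y = s, the other factor being positive.\<close>
  have lo: "s * y \<le> 1" if "4/5 \<le> fst p"
  proof -
    have "(s * y - 1) * (2 * (s * y) + 1) \<le> 0" using that D unfolding f
      by (simp add: field_simps) (simp add: D_def algebra_simps power2_eq_square ss)
    moreover have "0 < 2 * (s * y) + 1" using s y by (simp add: add_nonneg_pos)
    ultimately show ?thesis by (simp add: mult_le_0_iff)
  qed
  have lo': "1 \<le> s * y" if "fst p \<le> 4/5"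
  proof -
    have "(s * y - 1) * (2 * (s * y) + 1) \<ge> 0" using that D unfolding f
      by (simp add: field_simps) (simp add: D_def algebra_simps power2_eq_square ss)
    moreover have "0 < 2 * (s * y) + 1" using s y by (simp add: add_nonneg_pos)
    ultimately show ?thesis by (simp add: zero_le_mult_iff)
  qed
  have hi: "y \<le> s" if "3/5 \<le> fst p"
  proof -
    have "(y - s) * (3 * y + s) \<le> 0" using that D unfolding f
      by (simp add: field_simps) (simp add: D_def algebra_simps power2_eq_square ss s)
    moreover have "0 < 3 * y + s" using s y by simp
    ultimately show ?thesis by (simp add: mult_le_0_iff)
  qed
  have hi': "s \<le> y" if "fst p \<le> 3/5"
  proof -
    have "(y - s) * (3 * y + s) \<ge> 0" using that D unfolding f
      by (simp add: field_simps) (simp add: D_def algebra_simps power2_eq_square ss s)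
    moreover have "0 < 3 * y + s" using s y by simp
    ultimately show ?thesis by (simp add: zero_le_mult_iff)
  qed
  \<comment> \<open>The point with s * y = 1 is (4/5, 3/5), which \<open>romik\<close> sends to (0,
    1).\<close>
  have ne: "s * y \<noteq> 1"
  proof
    assume e: "s * y = 1"
    then have "2 * y = s" using ss[of y] by simp
    then have "y = s / 2" by simp
    then have "y\<^sup>2 = (s / 2)\<^sup>2" by (simp only:)
    also have "\<dots> = (s * s) / 4" by (simp add: power2_eq_square)
    finally have "y\<^sup>2 = (s * s) / 4" .
    then have y2: "y\<^sup>2 = 1/2" unfolding s by simp
    have "p = (4/5, 3/5)" unfolding y circle_pt_def s_def[symmetric] e y2 by simp
    then show False using pos by (simp add: romik_def)
  qed
  \<comment> \<open>In each case the witness comes from solving \<open>y = digit_act d z\<close> for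
    z.\<close>
  obtain z where z: "0 \<le> z" "y = digit_act d z"
  proof (cases d)
    case D1
    then have "s * y \<le> 1" using lo d by simp
    then have sy: "s * y < 1" using ne by simp
    have "s * (y / (1 - s * y)) + 1 = 1 / (1 - s * y)" using sy by (simp add: field_simps)
    then have "y = digit_act d (y / (1 - s * y))" unfolding D1 using sy by (simp add: s_def)
    moreover have "0 \<le> y / (1 - s * y)" using sy y by simp
    ultimately show ?thesis using that by blast
  next
    case D2
    then have "1 \<le> s * y" "y \<le> s" using lo' hi d by simp_all
    then have "1 < s * y" using ne by simp
    define z where "z = (s - y) / (s * y - 1)"
    have z: "z * (s * y - 1) = s - y" unfolding z_def using \<open>1 < s * y\<close> by simp
    have "0 \<le> z" unfolding z_def using \<open>1 < s * y\<close> \<open>y \<le> s\<close> by simp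
    moreover have "0 < s * z + 1" using s \<open>0 \<le> z\<close> by (smt (verit) mult_nonneg_nonneg)
    moreover have "y * (s * z + 1) = z + s" using z by (simp add: algebra_simps)
    ultimately show ?thesis using that[of z] unfolding D2 by (simp add: field_simps s_def[symmetric])
  next
    case D3
    then have "0 \<le> y - s" "y = digit_act d (y - s)" using hi' d by (auto simp: s_def)
    then show ?thesis using that by blast
  qed
  have "romik p = circle_pt z" using circle_pt_digit_act[OF z(1)] unfolding y z(2) by simp
  then show ?thesis using that z y by simp
qed

subsection \<open>Values of infinite words\<close>

text \<open>The Moebius transformations of the two Cohn matrices.\<close>

primrec cohn_act :: "ab \<Rightarrow> real \<Rightarrow> real" where
  "cohn_act La x = (3 * x + sqrt 2) / (sqrt 2 * x + 1)"
| "cohn_act Lb x = (sqrt 2 * x + 1) / (x + sqrt 2)"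

lemma stream_eqI: "(\<And>n. s !! n = t !! n) \<Longrightarrow> s = t"
  using smap_alt[of id s t] by (simp add: stream.map_id)

lemma vee_letter_vee_letter [simp]: "vee_letter (vee_letter l) = l"
  by (cases l) simp_all

lemma vee_vee [simp]: "vee (vee E) = E"
  unfolding vee_def by (intro stream_eqI) simp

lemma vee_SCons: "vee (l ## E) = vee_letter l ## vee E"
  unfolding vee_def by simp

lemma snth_jmath: "jmath X !! k = (case X !! k of Lb \<Rightarrow> Mb
    | La \<Rightarrow> if even (count_list (stake k X) Lb) then Ma else Mav)"
  unfolding jmath_def by simp

lemma jmath_La: "jmath (La ## X) = Ma ## jmath X"
proof (rule stream_eqI)
  show "jmath (La ## X) !! n = (Ma ## jmath X) !! n" for n
    using snth_jmath[of "La ## X" n] snth_jmath[of X "n - 1"] by (cases n) simp_all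
qed

text \<open>A leading \<open>Lb\<close> changes the parity of the number of earlier b's for every
  later letter.\<close>

lemma jmath_Lb: "jmath (Lb ## X) = Mb ## vee (jmath X)"
proof (rule stream_eqI)
  show "jmath (Lb ## X) !! n = (Mb ## vee (jmath X)) !! n" for n
    using snth_jmath[of "Lb ## X" n] snth_jmath[of X "n - 1"]
    by (cases n) (simp_all add: vee_def split: ab.split)
qed

lemma Pi_word_SCons: "Pi_word (l ## E) = Pi_letter l @- Pi_word E"
  unfolding Pi_word_def by (cases l) simp_all

text \<open>Exchanging 31 and 13 exchanges the digits 1 and 3. The induction is strong because a
  letter may produce two digits.\<close>

lemma Pi_word_vee: "Pi_word (vee E) = smap swap_digit (Pi_word E)"
proof (rule stream_eqI)
  fix n show "Pi_word (vee E) !! n = smap swap_digit (Pi_word E) !! n"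
  proof (induction n arbitrary: E rule: less_induct)
    case (less n)
    obtain l E' where E: "E = l ## E'" by (cases E)
    consider "l = Mb" | "l \<noteq> Mb" "n < 2" | m where "l \<noteq> Mb" "n = Suc (Suc m)"
      by (metis One_nat_def Suc_1 less_Suc_eq not0_implies_Suc zero_less_Suc)
    then show ?case
    proof cases
      case 1 then show ?thesis unfolding E vee_SCons Pi_word_SCons
        using less by (cases n) (auto simp: vee_SCons Pi_word_SCons)
    next
      case 2 then show ?thesis unfolding E vee_SCons Pi_word_SCons
        by (cases l) (auto simp: shift_snth less_2_cases_iff)
    next
      case 3 then show ?thesis unfolding E vee_SCons Pi_word_SCons
        using less[of m E'] by (cases l) auto
    qed
  qed
qed

text \<open>Each letter contributes a digit other than 3, so (0, 1) is never the point of such a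
  word and its norm stays finite.\<close>

lemma Pi_word_not_all_D3: "\<exists>n. Pi_word E !! n \<noteq> D3"
proof -
  obtain l E' where E: "E = l ## E'" by (cases E)
  show ?thesis
  proof (cases l)
    case Ma then show ?thesis unfolding E Pi_word_SCons by (intro exI[of _ 1]) simp
  qed (auto simp: E Pi_word_SCons intro!: exI[of _ 0])
qed

section \<open>Moebius action of the Cohn letters and limits of their products\<close>

lemma cohn_act_bounds:
  assumes "0 \<le> x" shows "1 / sqrt 2 \<le> cohn_act l x" "cohn_act l x \<le> 3"
proof -
  define s where "s = sqrt (2::real)"
  have s: "s * s = 2" "1 < s" "s < 2" unfolding s_def by (simp_all add: real_less_lsqrt)
  have ss: "s * (s * z) = 2 * z" for z using s(1) by (simp add: mult.assoc[symmetric])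
  have sx: "x \<le> s * x" "0 \<le> s * x" using s assms by (simp_all add: mult_le_cancel_right1)
  have "s * x \<le> 2 * x" using s assms by (intro mult_right_mono) simp_all
  show "1 / sqrt 2 \<le> cohn_act l x"
    using sx s assms by (cases l; simp add: s_def[symmetric] field_simps ss)
  show "cohn_act l x \<le> 3"
    using sx \<open>s * x \<le> 2 * x\<close> s assms by (cases l; simp add: s_def[symmetric] field_simps ss)
qed

lemma cohn_act_nonneg: "0 \<le> x \<Longrightarrow> 0 \<le> cohn_act l x"
  by (cases l) simp_all

text \<open>The numerators are x - y times the determinant, which is 1 for both matrices.\<close>

lemma cohn_act_diff:
  assumes "0 \<le> x" "0 \<le> y"
  shows "cohn_act La x - cohn_act La y = (x - y) / ((sqrt 2 * x + 1) * (sqrt 2 * y + 1))" (is ?A)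
    and "cohn_act Lb x - cohn_act Lb y = (x - y) / ((x + sqrt 2) * (y + sqrt 2))" (is ?B)
proof -
  define s where "s = sqrt (2::real)"
  have s: "s * s = 2" "0 < s" unfolding s_def by simp_all
  have ss: "s * (s * z) = 2 * z" for z using s(1) by (simp add: mult.assoc[symmetric])
  have p: "0 < s * x + 1" "0 < s * y + 1" "0 < x + s" "0 < y + s"
    using s assms by (simp_all add: add_nonneg_pos)
  have "(3 * x + s) * (s * y + 1) - (3 * y + s) * (s * x + 1) = x - y"
    "(s * x + 1) * (y + s) - (s * y + 1) * (x + s) = x - y"
    by (simp_all add: algebra_simps ss s)
  then show ?A ?B using p
    by (simp_all add: diff_frac_eq s_def[symmetric] less_imp_neq[THEN not_sym])
qed

lemma cohn_act_mono:
  assumes "0 \<le> x" "x \<le> y" shows "cohn_act l x \<le> cohn_act l y"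
proof -
  have "0 \<le> cohn_act l y - cohn_act l x"
    using assms by (cases l) (simp_all only: cohn_act_diff, simp_all)
  then show ?thesis by simp
qed

text \<open>On [1 / sqrt 2, \<infinity>), where all values lie after one letter, the denominators in
  \<open>cohn_act_diff\<close> are at least 4 for \<open>La\<close> and 2 for
  \<open>Lb\<close>.\<close>

lemma cohn_act_contraction:
  assumes "1 / sqrt 2 \<le> x" "1 / sqrt 2 \<le> y"
  shows "\<bar>cohn_act l x - cohn_act l y\<bar> \<le> \<bar>x - y\<bar> / 2"
proof -
  define s where "s = sqrt (2::real)"
  have s: "s * s = 2" "0 < s" unfolding s_def by simp_all
  have xy: "1 \<le> s * x" "1 \<le> s * y" using assms s unfolding s_def[symmetric] by (simp_all add: field_simps)
  have p: "0 < x" "0 < y" using assms by (smt (verit) divide_pos_pos real_sqrt_gt_zero)+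
  have *: "\<bar>(x - y) / d\<bar> \<le> \<bar>x - y\<bar> / 2" if "2 \<le> d" for d
    using that divide_left_mono[of 2 d "\<bar>x - y\<bar>"] by (simp add: abs_divide)
  have "2 * 2 \<le> (s * x + 1) * (s * y + 1)" using xy by (intro mult_mono) auto
  moreover have "s * s \<le> (x + s) * (y + s)" using p s by (intro mult_mono) auto
  ultimately have "2 \<le> (s * x + 1) * (s * y + 1)" "2 \<le> (x + s) * (y + s)"
    using s by simp_all
  then show ?thesis using p unfolding s_def
    by (cases l) (simp_all only: cohn_act_diff less_imp_le *)
qed

text \<open>The seed 0 is the least nonnegative value, so monotonicity of the letters makes the
  sequence increasing in n.\<close>

primrec approx_val :: "nat \<Rightarrow> ab stream \<Rightarrow> real" where
  "approx_val 0 X = 0"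
| "approx_val (Suc n) X = cohn_act (shd X) (approx_val n (stl X))"

definition word_val :: "ab stream \<Rightarrow> real" where
  "word_val X = lim (\<lambda>n. approx_val n X)"

lemma approx_val_bounds: "0 \<le> approx_val n X" "approx_val n X \<le> 3"
proof -
  have nonneg: "0 \<le> approx_val n X" for n X
    by (induction n arbitrary: X) (simp_all add: cohn_act_nonneg)
  then show "0 \<le> approx_val n X" .
  show "approx_val n X \<le> 3" by (cases n) (simp_all add: cohn_act_bounds(2)[OF nonneg])
qed

lemma approx_val_mono: "approx_val n X \<le> approx_val (Suc n) X"
proof (induction n arbitrary: X)
  case 0 then show ?case by (simp add: cohn_act_nonneg)
next
  case (Suc n)
  show ?case using cohn_act_mono[OF approx_val_bounds(1) Suc[of "stl X"]] by simp
qed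

lemma approx_val_tendsto: "(\<lambda>n. approx_val n X) \<longlonglongrightarrow> word_val X"
proof -
  have "convergent (\<lambda>n. approx_val n X)"
    using approx_val_bounds approx_val_mono
    by (intro Bseq_monoseq_convergent incseq_SucI[THEN monoseq_iff[THEN iffD2, OF disjI1]] BseqI'[where K = 3])
      (simp_all del: approx_val.simps)
  then show ?thesis unfolding word_val_def convergent_LIMSEQ_iff .
qed

lemma word_val_nonneg: "0 \<le> word_val X"
  using approx_val_tendsto approx_val_bounds(1) by (metis LIMSEQ_le_const)

lemma word_val_SCons: "word_val (l ## X) = cohn_act l (word_val X)"
proof -
  have "isCont (cohn_act l) (word_val X)"
  proof -
    have "0 < sqrt 2 * word_val X + 1" "0 < word_val X + sqrt 2"
      using word_val_nonneg[of X] by (simp_all add: add_nonneg_pos)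
    moreover have "cohn_act l = (case l of La \<Rightarrow> (\<lambda>x. (3 * x + sqrt 2) / (sqrt 2 * x + 1))
        | Lb \<Rightarrow> (\<lambda>x. (sqrt 2 * x + 1) / (x + sqrt 2)))"
      by (cases l) auto
    ultimately show ?thesis by (cases l) (auto intro!: continuous_intros)
  qed
  then have "(\<lambda>n. cohn_act l (approx_val n X)) \<longlonglongrightarrow> cohn_act l (word_val X)"
    using approx_val_tendsto isCont_tendsto_compose by blast
  moreover have "(\<lambda>n. cohn_act l (approx_val n X)) \<longlonglongrightarrow> word_val (l ## X)"
    using LIMSEQ_Suc[OF approx_val_tendsto[of "l ## X"]] by simp
  ultimately show ?thesis using LIMSEQ_unique by blast
qed

lemma word_val_bounds: "1 / sqrt 2 \<le> word_val X" "word_val X \<le> 3" "0 < word_val X"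
proof -
  show "1 / sqrt 2 \<le> word_val X" "word_val X \<le> 3"
    using cohn_act_bounds[OF word_val_nonneg] word_val_SCons by (metis stream.collapse)+
  then show "0 < word_val X" by (smt (verit) divide_pos_pos real_sqrt_gt_zero)
qed

section \<open>Points of the quarter circle belonging to words\<close>

lemma digit_act_Pi:
  assumes "0 \<le> x"
  shows "digit_act D3 (digit_act D1 x) = cohn_act La x"
    and "0 < x \<Longrightarrow> digit_act D2 (1 / x) = cohn_act Lb x"
proof -
  define s where "s = sqrt (2::real)"
  have s: "s * s = 2" "0 < s" unfolding s_def by simp_all
  have ss: "s * (s * z) = 2 * z" for z using s(1) by (simp add: mult.assoc[symmetric])
  have "0 < s * x + 1" using s assms by (simp add: add_nonneg_pos)
  then show "digit_act D3 (digit_act D1 x) = cohn_act La x"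
    by (simp add: s_def[symmetric] field_simps ss)
  \<comment> \<open>The inversion accounts for the \<open>vee\<close> that a letter
    \<open>Lb\<close> puts on everything after it.\<close>
  assume x: "0 < x"
  have "1 / x + s = (s * x + 1) / x" "s * (1 / x) + 1 = (x + s) / x"
    using x by (simp_all add: field_simps)
  then show "digit_act D2 (1 / x) = cohn_act Lb x"
    using x by (simp add: s_def[symmetric])
qed

text \<open>Existence of the expansion. A letter \<open>La\<close> consumes two digits;
  \<open>Lb\<close> consumes one, and the remaining expansion is that of the reflected
  point.\<close>

lemma digit_expansion_word_val:
  "digit_expansion (Pi_word (jmath X)) (circle_pt (word_val X))"
proof -
  have "has_digit (Pi_word (jmath X) !! n) ((romik ^^ n) (circle_pt (word_val X)))" for n
  proof (induction n arbitrary: X rule: less_induct)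
    case (less n)
    obtain l X' where X: "X = l ## X'" by (cases X)
    define v where "v = word_val X'"
    have v: "0 < v" "0 \<le> v" using word_val_bounds(3)[of X'] unfolding v_def by simp_all
    show ?case
    proof (cases l)
      case La
      have val: "word_val X = digit_act D3 (digit_act D1 v)"
        by (simp only: X word_val_SCons La v_def[symmetric] digit_act_Pi(1)[OF v(2)])
      have P: "Pi_word (jmath X) = D3 ## D1 ## Pi_word (jmath X')"
        unfolding X La jmath_La Pi_word_SCons by simp
      note 3 = circle_pt_digit_act[OF digit_act_nonneg[OF v(2)], of D3 D1]
      note 1 = circle_pt_digit_act[OF v(2), of D1]
      consider "n = 0" | "n = 1" | m where "n = Suc (Suc m)"
        by (metis One_nat_def not0_implies_Suc)
      then show ?thesis
      proof cases
        case 1 then show ?thesis using 3 unfolding val P by simp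
      next
        case 2 then show ?thesis using 1 3 unfolding val P by simp
      next
        case (3 m)
        then show ?thesis using less[of m X'] 1 \<open>_ \<and> romik (circle_pt (digit_act D3 _)) = _\<close>
          unfolding val P v_def[symmetric] by (simp del: digit_act.simps add: funpow_swap1)
      qed
    next
      case Lb
      have val: "word_val X = digit_act D2 (1 / v)"
        by (simp only: X word_val_SCons Lb v_def[symmetric] digit_act_Pi(2)[OF v(2,1)])
      have P: "Pi_word (jmath X) = D2 ## smap swap_digit (Pi_word (jmath X'))"
        unfolding X Lb jmath_Lb Pi_word_SCons Pi_word_vee by simp
      have 2: "has_digit D2 (circle_pt (digit_act D2 (1 / v)))"
        "romik (circle_pt (digit_act D2 (1 / v))) = prod.swap (circle_pt v)"
        using circle_pt_digit_act[of "1 / v" D2] v prod_swap_circle_pt[OF v(1)] by simp_all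
      have sw: "(romik ^^ m) (prod.swap p) = prod.swap ((romik ^^ m) p)" for m p
        by (induction m) (simp_all add: romik_swap)
      show ?thesis
      proof (cases n)
        case 0 then show ?thesis using 2 unfolding val P by simp
      next
        case (Suc m)
        then have "has_digit (Pi_word (jmath X') !! m) ((romik ^^ m) (circle_pt v))"
          using less[of m X'] unfolding v_def by simp
        then have "has_digit (swap_digit (Pi_word (jmath X') !! m)) ((romik ^^ m) (prod.swap (circle_pt v)))"
          unfolding sw using has_digit_swap romik_funpow_in_quarter_circle
            circle_pt_in_quarter_circle[OF v(2)] by blast
        then show ?thesis using 2 unfolding val P Suc
          by (simp del: digit_act.simps add: funpow_swap1)
      qed
    qed
  qed
  then show ?thesis unfolding digit_expansion_def by blast
qed

lemma digit_expansion_Pi_word_pos: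
  assumes "p \<in> quarter_circle" "digit_expansion (Pi_word E) p"
  shows "0 < fst p"
proof (rule ccontr)
  assume "\<not> 0 < fst p"
  then have "p = (0, 1)" using assms(1) unfolding quarter_circle_def
    by (cases p) (auto simp: power2_eq_1_iff)
  then show False using assms(2) digit_expansion_0_1 Pi_word_not_all_D3 by metis
qed

text \<open>One letter is peeled off by inverting its digits with
  \<open>romik_inverse_branch\<close>. The points reached have positive abscissa, either because
  their digit is 1 or because they carry the expansion of a word.\<close>

lemma digit_expansion_jmath_SCons:
  assumes x: "0 \<le> x" and dx: "digit_expansion (Pi_word (jmath (l ## X))) (circle_pt x)"
  obtains y where "0 \<le> y" "digit_expansion (Pi_word (jmath X)) (circle_pt y)" "x = cohn_act l y"
proof (cases l)
  case La
  define p where "p = circle_pt x"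
  have p: "p \<in> quarter_circle" "romik p \<in> quarter_circle" "romik (romik p) \<in> quarter_circle"
    unfolding p_def using circle_pt_in_quarter_circle[OF x] romik_in_quarter_circle by blast+
  have d: "has_digit D3 p" "has_digit D1 (romik p)" "digit_expansion (Pi_word (jmath X)) (romik (romik p))"
    using dx unfolding La jmath_La Pi_word_SCons p_def by (simp_all add: digit_expansion_SCons)
  have "0 < fst (romik p)" using d(2) by simp
  then obtain u where u: "0 \<le> u" "p = circle_pt (digit_act D3 u)" "romik p = circle_pt u"
    using romik_inverse_branch[OF p(1) d(1)] by metis
  have "0 < fst (romik (romik p))" using digit_expansion_Pi_word_pos[OF p(3) d(3)] .
  then obtain y where y: "0 \<le> y" "romik p = circle_pt (digit_act D1 y)" "romik (romik p) = circle_pt y"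
    using romik_inverse_branch[OF p(2) d(2)] by metis
  have "u = digit_act D1 y"
    using circle_pt_norm[OF u(1)] circle_pt_norm[OF digit_act_nonneg[OF y(1)]] u(3) y(2) by metis
  moreover have "x = digit_act D3 u"
    using circle_pt_norm[OF x] circle_pt_norm[OF digit_act_nonneg[OF u(1)]] u(2) p_def by metis
  ultimately have "x = cohn_act La y" using digit_act_Pi(1)[OF y(1)] by metis
  then show ?thesis using that[OF y(1)] d(3) y(3) La by simp
next
  case Lb
  define p where "p = circle_pt x"
  have p: "p \<in> quarter_circle" "romik p \<in> quarter_circle"
    unfolding p_def using circle_pt_in_quarter_circle[OF x] romik_in_quarter_circle by blast+
  have d: "has_digit D2 p" "digit_expansion (Pi_word (vee (jmath X))) (romik p)"
    using dx unfolding Lb jmath_Lb Pi_word_SCons p_def by (simp_all add: digit_expansion_SCons)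
  have "0 < fst (romik p)" using digit_expansion_Pi_word_pos[OF p(2) d(2)] .
  then obtain u where u: "0 \<le> u" "p = circle_pt (digit_act D2 u)" "romik p = circle_pt u"
    using romik_inverse_branch[OF p(1) d(1)] by metis
  define q where "q = prod.swap (romik p)"
  have q: "q \<in> quarter_circle" "romik p = prod.swap q" unfolding q_def using p by simp_all
  have dq: "digit_expansion (Pi_word (jmath X)) q"
    using d(2) digit_expansion_swap[OF q(1)] unfolding Pi_word_vee q(2) by simp
  obtain y where y: "0 \<le> y" "q = circle_pt y"
    using quarter_circle_pt[OF q(1) digit_expansion_Pi_word_pos[OF q(1) dq]] by blast
  \<comment> \<open>For y = 0 the point \<open>romik p\<close> would be (0, 1).\<close>
  have "0 < y"
  proof (rule ccontr)
    assume "\<not> 0 < y"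
    then have "q = (1, 0)" using y by (simp add: circle_pt_def)
    then show False using \<open>0 < fst (romik p)\<close> q by simp
  qed
  then have "romik p = circle_pt (1 / y)" using prod_swap_circle_pt y q by simp
  then have "u = 1 / y" using circle_pt_norm[OF u(1)] circle_pt_norm[of "1 / y"] u(3) \<open>0 < y\<close>
    by (metis less_imp_le zero_less_divide_1_iff)
  moreover have "x = digit_act D2 u"
    using circle_pt_norm[OF x] circle_pt_norm[OF digit_act_nonneg[OF u(1)]] u(2) p_def by metis
  ultimately have "x = cohn_act Lb y" using digit_act_Pi(2)[OF y(1) \<open>0 < y\<close>] by metis
  then show ?thesis using that[OF y(1)] dq y(2) Lb by simp
qed

text \<open>Peeling off n letters and contracting by 1/2 for each bounds the distance to
  \<open>word_val X\<close> by 3 / 2 ^ n.\<close>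

lemma digit_expansion_jmath_unique:
  assumes "0 \<le> x" "digit_expansion (Pi_word (jmath X)) (circle_pt x)"
  shows "x = word_val X"
proof -
  \<comment> \<open>Such a coordinate is itself a value of \<open>cohn_act\<close>, hence lies where
    the contraction estimate applies.\<close>
  have bounds: "1 / sqrt 2 \<le> y \<and> y \<le> 3"
    if "0 \<le> y" "digit_expansion (Pi_word (jmath Y)) (circle_pt y)" for y Y
    using digit_expansion_jmath_SCons[OF that(1), of "shd Y" "stl Y"] that(2) cohn_act_bounds
    by (metis stream.collapse)
  have close: "\<bar>y - word_val Y\<bar> \<le> 3 * (1/2) ^ n"
    if "0 \<le> y" "digit_expansion (Pi_word (jmath Y)) (circle_pt y)" for y Y n
    using that
  proof (induction n arbitrary: y Y)
    case 0
    then show ?case using bounds[OF 0] word_val_bounds[of Y] by (simp add: abs_le_iff)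
  next
    case (Suc n)
    obtain l Z where Y: "Y = l ## Z" by (cases Y)
    obtain z where z: "0 \<le> z" "digit_expansion (Pi_word (jmath Z)) (circle_pt z)" "y = cohn_act l z"
      using digit_expansion_jmath_SCons Suc.prems unfolding Y by metis
    have "\<bar>y - word_val Y\<bar> \<le> \<bar>z - word_val Z\<bar> / 2"
      unfolding z(3) Y word_val_SCons
      using cohn_act_contraction bounds[OF z(1,2)] word_val_bounds(1) by blast
    then show ?case using Suc.IH[OF z(1,2)] by simp
  qed
  have "(\<lambda>n. 3 * (1/2) ^ n) \<longlonglongrightarrow> (3 * 0 :: real)"
    by (intro tendsto_mult tendsto_const LIMSEQ_power_zero) simp
  then have "\<bar>x - word_val X\<bar> \<le> 3 * 0"
    by (rule LIMSEQ_le_const) (use close[OF assms] in blast)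
  then show ?thesis by simp
qed

lemma romik_point_jmath: "romik_point (Pi_word (jmath X)) = circle_pt (word_val X)"
  unfolding romik_point_def
proof (rule the_equality)
  show "circle_pt (word_val X) \<in> quarter_circle \<and> digit_expansion (Pi_word (jmath X)) (circle_pt (word_val X))"
    using digit_expansion_word_val circle_pt_in_quarter_circle[OF word_val_nonneg] by blast
next
  fix p assume p: "p \<in> quarter_circle \<and> digit_expansion (Pi_word (jmath X)) p"
  then obtain x where "0 \<le> x" "p = circle_pt x"
    using quarter_circle_pt digit_expansion_Pi_word_pos by metis
  then show "p = circle_pt (word_val X)" using digit_expansion_jmath_unique p by metis
qed

lemma romik_point_vee_jmath:
  "romik_point (Pi_word (vee (jmath X))) = circle_pt (1 / word_val X)"
proof -
  have "p \<in> quarter_circle \<and> digit_expansion (Pi_word (vee (jmath X))) p \<longleftrightarrow> p = circle_pt (1 / word_val X)" for p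
  proof -
    have "p \<in> quarter_circle \<and> digit_expansion (Pi_word (vee (jmath X))) p \<longleftrightarrow>
        prod.swap p \<in> quarter_circle \<and> digit_expansion (Pi_word (jmath X)) (prod.swap p)"
      using digit_expansion_swap[of "prod.swap p"] unfolding Pi_word_vee by auto
    also have "\<dots> \<longleftrightarrow> prod.swap p = circle_pt (word_val X)"
      using digit_expansion_word_val circle_pt_in_quarter_circle[OF word_val_nonneg]
        quarter_circle_pt digit_expansion_Pi_word_pos digit_expansion_jmath_unique by metis
    also have "\<dots> \<longleftrightarrow> p = prod.swap (circle_pt (word_val X))"
      by (metis swap_swap)
    finally show ?thesis unfolding prod_swap_circle_pt[OF word_val_bounds(3)] .
  qed
  then show ?thesis unfolding romik_point_def by simp
qed

lemma romik_norm_circle_pt: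
  assumes "romik_point P = circle_pt x" "0 < x"
  shows "romik_norm P = ereal x"
proof -
  have "fst (circle_pt x) \<noteq> 0"
    using assms(2) circle_pt_denom[of x] by (simp add: circle_pt_def add_nonneg_pos less_imp_neq[THEN not_sym]
        add_pos_pos)
  then show ?thesis
    using circle_pt_norm[of x] assms unfolding romik_norm_def
    by (simp add: case_prod_beta)
qed

lemma romik_norm_jmath:
  "romik_norm (Pi_word (jmath X)) = ereal (word_val X)"
  "romik_norm (Pi_word (vee (jmath X))) = ereal (1 / word_val X)"
  using romik_norm_circle_pt romik_point_jmath romik_point_vee_jmath word_val_bounds(3)
  by (simp_all add: romik_norm_circle_pt)

subsection \<open>Sections of doubly infinite words\<close>

definition right_word :: "(int \<Rightarrow> 'a) \<Rightarrow> int \<Rightarrow> 'a stream" where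
  "right_word g n = smap (\<lambda>i. g (n + int i)) nats"

definition left_word :: "(int \<Rightarrow> 'a) \<Rightarrow> int \<Rightarrow> 'a stream" where
  "left_word g n = smap (\<lambda>i. g (n - 1 - int i)) nats"

lemma snth_right_word [simp]: "right_word g n !! i = g (n + int i)"
  unfolding right_word_def by simp

lemma snth_left_word [simp]: "left_word g n !! i = g (n - 1 - int i)"
  unfolding left_word_def by simp

lemma right_word_unfold: "right_word g n = g n ## right_word g (n + 1)"
proof (rule stream_eqI)
  show "right_word g n !! i = (g n ## right_word g (n + 1)) !! i" for i
    using snth_right_word[of g n i] snth_right_word[of g "n + 1" "i - 1"]
    by (cases i) (simp_all add: algebra_simps)
qed

lemma left_word_unfold: "left_word g (n + 1) = g n ## left_word g n"
proof (rule stream_eqI)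
  show "left_word g (n + 1) !! i = (g n ## left_word g n) !! i" for i
    using snth_left_word[of g "n + 1" i] snth_left_word[of g n "i - 1"]
    by (cases i) (simp_all add: algebra_simps)
qed

lemma join_eq_shift_iff:
  "join E F = (\<lambda>k. g (k + n)) \<longleftrightarrow> E = left_word g n \<and> F = right_word g n"
proof
  assume h: "join E F = (\<lambda>k. g (k + n))"
  have "E !! i = left_word g n !! i" for i
    using fun_cong[OF h, of "- 1 - int i"] by (simp add: join_def algebra_simps)
  moreover have "F !! i = right_word g n !! i" for i
    using fun_cong[OF h, of "int i"] by (simp add: join_def algebra_simps)
  ultimately show "E = left_word g n \<and> F = right_word g n" using stream_eqI by blast
next
  assume "E = left_word g n \<and> F = right_word g n"
  then show "join E F = (\<lambda>k. g (k + n))"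
    by (auto simp: join_def fun_eq_iff add.commute)
qed

text \<open>Sections are base points: every representative is a shift of g, and \<open>join\<close>
  splits it uniquely.\<close>

lemma sections_abs_biword:
  "sections (abs_biword g) = range (\<lambda>n. (left_word g n, right_word g n))"
proof -
  have "abs_biword f = abs_biword g \<longleftrightarrow> (\<exists>n. f = (\<lambda>k. g (k + n)))" for f
    using biword.abs_eq_iff[of g f] unfolding shift_equiv_def fun_eq_iff by (auto simp: eq_commute)
  then show ?thesis unfolding sections_def by (auto simp: join_eq_shift_iff)
qed

text \<open>Moving the base point across an a leaves d alone, and moving it across a b composes d
  with \<open>vee\<close> on both halves at once. So up to a common \<open>vee\<close>, every
  section comes from a section of c.\<close>

lemma join_jmath_shift:
  fixes c :: "int \<Rightarrow> ab"
  defines "G \<equiv> join (jmath (left_word c 0)) (jmath (right_word c 0))"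
  shows "\<exists>d \<in> {id, vee}. left_word G n = d (jmath (left_word c n)) \<and>
    right_word G n = d (jmath (right_word c n))" (is "?P n")
proof -
  have step: "?P n \<longleftrightarrow> ?P (n + 1)" for n
    unfolding right_word_unfold[of _ n] left_word_unfold
    by (cases "c n") (auto simp: jmath_La jmath_Lb vee_SCons)
  have "G = (\<lambda>k. G (k + 0))" by simp
  then have "jmath (left_word c 0) = left_word G 0 \<and> jmath (right_word c 0) = right_word G 0"
    using join_eq_shift_iff G_def by metis
  then have 0: "?P 0" by auto
  show ?thesis
  proof (induction n rule: int_induct[where k = 0])
    case base show ?case by (rule 0)
  next
    case (step1 i) then show ?case using step by blast
  next
    case (step2 i) then show ?case using step[of "i - 1"] by simp
  qed
qed

lemma L_section_jmath:
  "L_section (jmath X) (jmath Y) = ereal ((1 / word_val X + word_val Y) / sqrt 2)"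
  "L_section (vee (jmath X)) (vee (jmath Y)) = ereal ((word_val X + 1 / word_val Y) / sqrt 2)"
  unfolding L_section_def by (simp_all add: romik_norm_jmath)

text \<open>If m and M are the values of the left and right word at 0, all half-word values
  considered lie between m and M. Hence both 1 / left + right and left + 1 / right are at most 1 / m
  + M, with equality for the first at base point 0.\<close>

lemma L_biword_extremal_section:
  fixes c :: "int \<Rightarrow> ab"
  assumes "\<And>n. word_val (right_word c n) \<le> word_val (right_word c 0)"
    and "\<And>n. word_val (left_word c n) \<le> word_val (right_word c 0)"
    and "\<And>n. word_val (left_word c 0) \<le> word_val (right_word c n)"
    and "\<And>n. word_val (left_word c 0) \<le> word_val (left_word c n)"
  shows "L_biword (abs_biword (join (jmath (left_word c 0)) (jmath (right_word c 0)))) =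
    ereal ((1 / word_val (left_word c 0) + word_val (right_word c 0)) / sqrt 2)" (is "?L = ?v")
proof -
  define G where "G = join (jmath (left_word c 0)) (jmath (right_word c 0))"
  have inv: "1 / word_val X \<le> 1 / word_val Y" if "word_val Y \<le> word_val X" for X Y
    using that word_val_bounds(3) by (simp add: frac_le)
  have le: "L_section (jmath (left_word c n)) (jmath (right_word c n)) \<le> ?v"
    "L_section (vee (jmath (left_word c n))) (vee (jmath (right_word c n))) \<le> ?v" for n
    unfolding L_section_jmath
    using assms(1)[of n] assms(2)[of n] inv[OF assms(3)[of n]] inv[OF assms(4)[of n]]
    by (simp_all add: divide_right_mono)
  have "L_biword (abs_biword G) = ?v"
    unfolding L_biword_def sections_abs_biword
  proof (rule antisym)
    show "(SUP (E, F) \<in> range (\<lambda>n. (left_word G n, right_word G n)).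
        max (L_section E F) (L_section (vee E) (vee F))) \<le> ?v"
    proof (rule SUP_least, clarsimp)
      fix n
      show "L_section (left_word G n) (right_word G n) \<le> ?v \<and>
        L_section (vee (left_word G n)) (vee (right_word G n)) \<le> ?v"
        using join_jmath_shift[of c n] le[of n] unfolding G_def by auto
    qed
    have "G = (\<lambda>k. G (k + 0))" by simp
    then have "jmath (left_word c 0) = left_word G 0" "jmath (right_word c 0) = right_word G 0"
      using join_eq_shift_iff G_def by metis+
    then have "?v \<le> max (L_section (left_word G 0) (right_word G 0))
        (L_section (vee (left_word G 0)) (vee (right_word G 0)))"
      using L_section_jmath(1)[of "left_word c 0" "right_word c 0"] by simp
    then show "?v \<le> (SUP (E, F) \<in> range (\<lambda>n. (left_word G n, right_word G n)).
        max (L_section E F) (L_section (vee E) (vee F)))"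
      by (intro SUP_upper2[where i = "(left_word G 0, right_word G 0)"]) auto
  qed
  then show ?thesis unfolding G_def .
qed

text \<open>At the first position where the words differ, the prefix counts force an a in X and a b
  in Y; the common letters before it are increasing maps.\<close>

lemma word_val_antimono:
  assumes "\<And>k. count_list (stake k X) Lb \<le> count_list (stake k Y) Lb"
  shows "word_val Y \<le> word_val X"
proof -
  have heads: "word_val Y \<le> word_val X"
    if c: "\<And>k. count_list (stake k X) Lb \<le> count_list (stake k Y) Lb" and "shd X \<noteq> shd Y" for X Y
  proof -
    have "shd X = La \<and> shd Y = Lb"
      using c[of 1] that(2) by (cases "shd X"; cases "shd Y") auto
    then obtain X' Y' where XY: "X = La ## X'" "Y = Lb ## Y'" by (metis stream.collapse)
    define u v where "u = word_val X'" and "v = word_val Y'"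
    have uv: "0 \<le> u" "0 \<le> v" unfolding u_def v_def by (simp_all add: word_val_nonneg)
    define s where "s = sqrt (2::real)"
    have s: "s * s = 2" "0 < s" unfolding s_def by simp_all
    have ss: "s * (s * z) = 2 * z" for z using s(1) by (simp add: mult.assoc[symmetric])
    have "0 < s * u + 1" "0 < v + s" using s uv by (simp_all add: add_nonneg_pos)
    \<comment> \<open>The value sqrt 2 separates the two letters: B stays below it and A above it on
      nonnegative arguments.\<close>
    then have "(s * v + 1) / (v + s) \<le> s" "s \<le> (3 * u + s) / (s * u + 1)"
      using s uv by (simp_all add: field_simps ss)
    then show ?thesis unfolding XY word_val_SCons u_def[symmetric] v_def[symmetric]
      by (simp add: s_def)
  qed
  have differ: "word_val Y \<le> word_val X"
    if "X !! n \<noteq> Y !! n" "\<And>k. count_list (stake k X) Lb \<le> count_list (stake k Y) Lb" for n X Y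
    using that
  proof (induction n arbitrary: X Y)
    case 0
    then show ?case using heads by simp
  next
    case (Suc n)
    show ?case
    proof (cases "shd X = shd Y")
      case True
      then obtain l X' Y' where XY: "X = l ## X'" "Y = l ## Y'" by (metis stream.collapse)
      have "count_list (stake k X') Lb \<le> count_list (stake k Y') Lb" for k
        using Suc.prems(2)[of "Suc k"] unfolding XY by (simp split: if_splits)
      then have "word_val Y' \<le> word_val X'" using Suc.IH Suc.prems(1) unfolding XY by simp
      then show ?thesis unfolding XY word_val_SCons
        using cohn_act_mono word_val_nonneg by blast
    qed (use heads Suc.prems(2) in blast)
  qed
  show ?thesis
  proof (cases "X = Y")
    case False
    then obtain n where "X !! n \<noteq> Y !! n" using stream_eqI by blast
    then show ?thesis using differ assms by blast
  qed simp
qed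

subsection \<open>Christoffel words\<close>

lemma snth_cycle: "u \<noteq> [] \<Longrightarrow> cycle u !! i = u ! (i mod length u)"
proof (induction i rule: less_induct)
  case (less i)
  show ?case
  proof (cases "i < length u")
    case True
    then show ?thesis using cycle_decomp[OF less.prems] by (metis mod_less shift_snth_less)
  next
    case False
    then have "cycle u !! i = cycle u !! (i - length u)"
      using cycle_decomp[OF less.prems] by (metis not_less shift_snth_ge)
    moreover have "i - length u < i" using False less.prems by (cases u) auto
    ultimately show ?thesis using less.IH less.prems False by (simp add: le_mod_geq)
  qed
qed

definition periodic_word :: "'a list \<Rightarrow> int \<Rightarrow> 'a" where
  "periodic_word w k = w ! nat (k mod int (length w))"

lemma right_word_periodic_word: "w \<noteq> [] \<Longrightarrow> right_word (periodic_word w) 0 = cycle w"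
  by (rule stream_eqI) (simp add: periodic_word_def snth_cycle nat_mod_distrib)

lemma left_word_periodic_word:
  assumes "w \<noteq> []" shows "left_word (periodic_word w) 0 = cycle (rev w)"
proof (rule stream_eqI)
  fix i
  define n r where "n = length w" and "r = i mod n"
  have n: "0 < n" "r < n" using assms unfolding n_def r_def by simp_all
  have "int i = int n * (int i div int n) + int r" unfolding r_def by (simp add: zmod_int)
  \<comment> \<open>Modulo n, position -1 - i is n - 1 - r, the r-th letter from the end of
    w.\<close>
  then have "- 1 - int i = int (n - 1 - r) + int n * (- 1 - int i div int n)"
    using n by (simp add: algebra_simps of_nat_diff)
  then have "(- 1 - int i) mod int n = (int (n - 1 - r) + int n * (- 1 - int i div int n)) mod int n"
    by (rule arg_cong)
  also have "\<dots> = int (n - 1 - r) mod int n" by (rule mod_mult_self2)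
  also have "\<dots> = int (n - 1 - r)" using n by (intro mod_pos_pos_trivial) simp_all
  finally have "nat ((- 1 - int i) mod int n) = nat (int (n - 1 - r))" by (rule arg_cong)
  then have "nat ((- 1 - int i) mod int n) = n - Suc r" by simp
  then show "left_word (periodic_word w) 0 !! i = cycle (rev w) !! i"
    using assms n by (simp add: periodic_word_def snth_cycle rev_nth n_def[symmetric] r_def[symmetric])
qed

text \<open>A height h whose increments mark the b's turns prefix counts in both reading directions
  into differences of h.\<close>

lemma count_periodic_word:
  fixes h :: "int \<Rightarrow> int"
  assumes h: "\<And>k. h (k + 1) - h k = (if c k = Lb then 1 else 0)"
  shows "int (count_list (stake k (right_word c m)) Lb) = h (m + int k) - h m"
    and "int (count_list (stake k (left_word c m)) Lb) = h m - h (m - int k)"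
proof -
  show "int (count_list (stake k (right_word c m)) Lb) = h (m + int k) - h m"
  proof (induction k)
    case (Suc k)
    show ?case using Suc h[of "m + int k"] unfolding stake_Suc
      by (auto simp: algebra_simps split: if_splits)
  qed simp
  show "int (count_list (stake k (left_word c m)) Lb) = h m - h (m - int k)"
  proof (induction k)
    case (Suc k)
    show ?case using Suc h[of "m - 1 - int k"] unfolding stake_Suc
      by (auto simp: algebra_simps split: if_splits)
  qed simp
qed

lemma div_superadditive:
  fixes n :: int
  assumes "0 < n"
  shows "x div n + y div n \<le> (x + y) div n"
proof -
  have "(x + y) div n = x div n + y div n + (x mod n + y mod n) div n" by (rule div_add1_eq)
  moreover have "0 \<le> (x mod n + y mod n) div n"
    using assms by (simp add: pos_imp_zdiv_nonneg_iff)
  ultimately show ?thesis by simp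
qed

text \<open>The floor of k t / n is such a height on all integers: writing k = r + q n reduces the
  claim to the first period, where the floor is the prefix count.\<close>

lemma periodic_word_height:
  assumes w: "w \<noteq> []"
    and cnt: "\<And>k. k \<le> length w \<Longrightarrow> count_list (take k w) Lb = k * t div length w"
  shows "(k + 1) * int t div int (length w) - k * int t div int (length w) =
    (if periodic_word w k = Lb then 1 else 0)"
proof -
  define n where "n = length w"
  have n: "0 < n" using w unfolding n_def by simp
  define q where "q = k div int n"
  define r where "r = nat (k mod int n)"
  have r: "r < n" "int r = k mod int n" unfolding r_def using n by (simp_all add: nat_less_iff)
  have k: "k = int r + q * int n" unfolding q_def r by simp
  have "(k + 1) * int t = int (Suc r * t) + (q * int t) * int n"
    "k * int t = int (r * t) + (q * int t) * int n"
    unfolding k by (simp_all add: algebra_simps)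
  then have "(k + 1) * int t div int n = q * int t + int (Suc r * t div n)"
    "k * int t div int n = q * int t + int (r * t div n)"
    using n by (simp_all only: div_mult_self1 zdiv_int)
  moreover have "Suc r * t div n = r * t div n + (if w ! r = Lb then 1 else 0)"
    using cnt[of r] cnt[of "Suc r"] r(1) unfolding n_def[symmetric]
    by (simp add: take_Suc_conv_app_nth n_def del: mult_Suc split: if_splits)
  moreover have "periodic_word w k = w ! r"
    unfolding periodic_word_def r_def n_def ..
  ultimately show ?thesis unfolding n_def[symmetric] by simp
qed

text \<open>Superadditivity and h 0 = 0 give h k \<le> h (m + k) - h m \<le> - h (- k) for all
  integers m. The outer terms count the b's in the length-k prefixes of the right and the left word
  at 0, the middle one those in an arbitrary window of length k.\<close>

lemma word_val_periodic_extremal: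
  assumes w: "w \<noteq> []"
    and cnt: "\<And>k. k \<le> length w \<Longrightarrow> count_list (take k w) Lb = k * t div length w"
  shows "word_val (right_word (periodic_word w) m) \<le> word_val (right_word (periodic_word w) 0)"
    and "word_val (left_word (periodic_word w) m) \<le> word_val (right_word (periodic_word w) 0)"
    and "word_val (left_word (periodic_word w) 0) \<le> word_val (right_word (periodic_word w) m)"
    and "word_val (left_word (periodic_word w) 0) \<le> word_val (left_word (periodic_word w) m)"
proof -
  define h where "h = (\<lambda>k. k * int t div int (length w))"
  have "h (k + 1) - h k = (if periodic_word w k = Lb then 1 else 0)" for k
    unfolding h_def using periodic_word_height[OF w cnt] by blast
  note count = count_periodic_word[of h "periodic_word w", OF this]
  have sup: "h x + h y \<le> h (x + y)" for x y
    unfolding h_def using div_superadditive[of "int (length w)" "x * int t" "y * int t"] w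
    by (simp add: distrib_right)
  have h0: "h 0 = 0" unfolding h_def by simp
  have le: "count_list (stake k X) Lb \<le> count_list (stake k Y) Lb \<longleftrightarrow>
    int (count_list (stake k X) Lb) \<le> int (count_list (stake k Y) Lb)" for k X Y by simp
  show "word_val (right_word (periodic_word w) m) \<le> word_val (right_word (periodic_word w) 0)"
    proof (rule word_val_antimono, unfold le count)
    show "h (0 + int k) - h 0 \<le> h (m + int k) - h m" for k
      using sup[of m "int k"] h0 by simp
  qed
  show "word_val (left_word (periodic_word w) m) \<le> word_val (right_word (periodic_word w) 0)"
  proof (rule word_val_antimono, unfold le count)
    show "h (0 + int k) - h 0 \<le> h m - h (m - int k)" for k
      using sup[of "m - int k" "int k"] h0 by simp
  qed
  show "word_val (left_word (periodic_word w) 0) \<le> word_val (right_word (periodic_word w) m)"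
  proof (rule word_val_antimono, unfold le count)
    show "h (m + int k) - h m \<le> h 0 - h (0 - int k)" for k
      using sup[of "m + int k" "- int k"] h0 by simp
  qed
  show "word_val (left_word (periodic_word w) 0) \<le> word_val (left_word (periodic_word w) m)"
  proof (rule word_val_antimono, unfold le count)
    show "h m - h (m - int k) \<le> h 0 - h (0 - int k)" for k
      using sup[of m "- int k"] h0 by simp
  qed
qed

text \<open>For a path point (i, j) with i + j = k, lying on or below the segment means (s + t) j
  \<le> k t; the absence of lattice points in between makes j the largest such integer.\<close>

lemma lower_christoffel_prefix_count:
  assumes st: "0 < s" "0 < t" "coprime s t" and w: "lower_christoffel_of_slope s t w"
  shows "length w = s + t" and "k \<le> length w \<Longrightarrow> count_list (take k w) Lb = k * t div (s + t)"
proof -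
  have len: "count_list u La + count_list u Lb = length u" for u
  proof (induction u)
    case (Cons x u) then show ?case by (cases x) auto
  qed simp
  have end_pt: "count_list w La = s" "count_list w Lb = t"
    using w unfolding lower_christoffel_of_slope_def path_point_def by auto
  then show n: "length w = s + t" using len[of w] by simp
  assume k: "k \<le> length w"
  define i j where "i = count_list (take k w) La" and "j = count_list (take k w) Lb"
  have ij: "i + j = k" unfolding i_def j_def using len[of "take k w"] k by simp
  have "(i, j) \<in> path_points w"
    unfolding path_points_def path_point_def i_def j_def using k by auto
  then have "s * j \<le> t * i" using w unfolding lower_christoffel_of_slope_def by auto
  then have up: "(s + t) * j \<le> k * t" using ij by (auto simp: algebra_simps)
  \<comment> \<open>Otherwise (i - 1, j + 1), the next lattice point on the line i + j = k, lies
    strictly between path and segment.\<close>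
  have "k * t < (s + t) * (j + 1)"
  proof (rule ccontr)
    assume "\<not> k * t < (s + t) * (j + 1)"
    then have h: "(s + t) * (j + 1) \<le> k * t" by simp
    \<comment> \<open>By coprimality the segment meets such a lattice point only at its endpoints, k
      = 0 or k = s + t, where j + 1 is too large.\<close>
    have ne: "(s + t) * (j + 1) \<noteq> k * t"
    proof
      assume e: "(s + t) * (j + 1) = k * t"
      have "coprime (s + t) t" using st(3) by (simp add: coprime_iff_gcd_eq_1)
      moreover have "s + t dvd k * t" using e by (metis dvd_triv_left)
      ultimately have "s + t dvd k" by (simp add: coprime_dvd_mult_left_iff)
      then have "k = 0 \<or> k = s + t" using k n by (auto dest: dvd_imp_le)
      then show False
      proof
        assume "k = 0" then show False using e st by simp
      next
        assume "k = s + t"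
        then have "j + 1 = t" using e st by (metis add_pos_pos mult_cancel1 not_gr_zero)
        moreover have "j = t" unfolding j_def using \<open>k = s + t\<close> n end_pt by simp
        ultimately show False by simp
      qed
    qed
    have lt: "(s + t) * (j + 1) < k * t" using h ne by simp
    then have i0: "0 < i" using ij by (cases i) (auto simp: algebra_simps)
    have "s * (j + 1) + t * (j + 1) < t * (i + j)" using lt ij by (simp add: algebra_simps)
    then have below: "s * (j + 1) < t * (i - 1)"
      using i0 by (cases i) (auto simp: algebra_simps)
    have i_le: "i \<le> s" 
      using end_pt(1) count_list_append[of "take k w" "drop k w" La] unfolding i_def append_take_drop_id by simp
    have "y < j + 1" if "(i - 1, y) \<in> path_points w" for y
    proof -
      obtain l where l: "l \<le> length w" "count_list (take l w) La = i - 1" "count_list (take l w) Lb = y"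
        using \<open>(i - 1, y) \<in> path_points w\<close> unfolding path_points_def path_point_def by auto
      have mono: "count_list (take a w) x \<le> count_list (take b w) x" if "a \<le> b" for a b x
      proof -
        have "take b w = take a w @ take (b - a) (drop a w)"
          using that take_add[of a "b - a" w] by simp
        then show ?thesis by simp
      qed
      \<comment> \<open>After k letters the abscissa is already i, so the path visits abscissa i - 1
        only earlier, at height at most j.\<close>
      have "l \<le> k"
      proof (rule ccontr)
        assume "\<not> l \<le> k"
        then have "i \<le> i - 1" using mono[of k l La] l(2) unfolding i_def by simp
        then show False using i0 by simp
      qed
      then show ?thesis using mono[of l k Lb] l(3) unfolding j_def by simp
    qed
    then have "strictly_between s t w (i - 1, j + 1)"
      unfolding strictly_between_def using below i_le by simp
    then show False using w unfolding lower_christoffel_of_slope_def by blast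
  qed
  then have "k * t div (s + t) = j"
    using up by (intro div_nat_eqI) (simp_all add: algebra_simps)
  then show "count_list (take k w) Lb = k * t div (s + t)" unfolding j_def by simp
qed

text \<open>The height satisfies h (n - k) = t - 1 - h k for 0 < k < n, so its increments at k and n
  - 1 - k agree; only the two end letters escape this symmetry.\<close>

lemma lower_christoffel_palindrome:
  assumes st: "0 < s" "0 < t" "coprime s t" and w: "lower_christoffel_of_slope s t w"
  obtains p where "w = La # p @ [Lb]" "rev p = p"
proof -
  define n where "n = length w"
  have n: "n = s + t" and cnt: "\<And>k. k \<le> length w \<Longrightarrow> count_list (take k w) Lb = k * t div length w"
    using lower_christoffel_prefix_count[OF st w] unfolding n_def by auto
  have ne: "w \<noteq> []" using n st unfolding n_def by auto
  define h where "h = (\<lambda>k. k * int t div int n)"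
  have step: "h (int k + 1) - h (int k) = (if w ! k = Lb then 1 else 0)" if "k < n" for k
    using periodic_word_height[OF ne cnt, of "int k"] that
    unfolding h_def n_def periodic_word_def by simp
  have reflect: "h (int n - k) = int t - 1 - h k" if "0 < k" "k < int n" for k
  proof -
    \<comment> \<open>Since k t / n is not an integer, the floor of its negative is one below minus
      its floor; this is the -1 in \<open>reflect\<close>.\<close>
    have "\<not> int n dvd k * int t"
    proof
      assume "int n dvd k * int t"
      moreover have "coprime (int n) (int t)"
        using st(3) unfolding n by (simp add: coprime_iff_gcd_eq_1)
      ultimately have "int n dvd k" by (simp add: coprime_dvd_mult_left_iff)
      then show False using that zdvd_imp_le by fastforce
    qed
    then have "- (k * int t) div int n = - (k * int t div int n) - 1"
      using n st by (simp add: zdiv_zminus1_eq_if dvd_eq_mod_eq_0)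
    moreover have "(int n - k) * int t = - (k * int t) + int t * int n" by (simp add: algebra_simps)
    ultimately show ?thesis unfolding h_def using n st by (simp only: div_mult_self1)
  qed
  have n2: "2 \<le> n" using n st by simp
  have h0: "h 0 = 0" unfolding h_def by simp
  have h1: "h 1 = 0" unfolding h_def using n st by simp
  have hn: "h (int n) = int t" unfolding h_def using n2 by simp
  have first: "w ! 0 = La" using step[of 0] n2 h0 h1 by (cases "w ! 0") auto
  have "h (int n - 1) = int t - 1" using reflect[of 1] n2 h1 by simp
  then have last: "w ! (n - 1) = Lb" using step[of "n - 1"] n2 hn
    by (simp add: of_nat_diff split: if_splits)
  have sym: "w ! (n - 1 - k) = w ! k" if "0 < k" "k < n - 1" for k
  proof -
    have "int (n - 1 - k) = int n - (int k + 1)" "int (n - 1 - k) + 1 = int n - int k"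
      using that by (simp_all add: of_nat_diff)
    moreover have "h (int n - (int k + 1)) = int t - 1 - h (int k + 1)"
      "h (int n - int k) = int t - 1 - h (int k)"
      using that by (intro reflect; simp)+
    ultimately have "h (int (n - 1 - k) + 1) - h (int (n - 1 - k)) = h (int k + 1) - h (int k)"
      by (simp only:)
    then have "w ! (n - 1 - k) = Lb \<longleftrightarrow> w ! k = Lb"
      using step[of k] step[of "n - 1 - k"] that by (simp split: if_splits)
    then show ?thesis by (metis ab.exhaust)
  qed
  define p where "p = map (\<lambda>i. w ! Suc i) [0..<n - 2]"
  have p_nth: "p ! j = w ! Suc j" if "j < n - 2" for j
    using that unfolding p_def by simp
  have "w = La # p @ [Lb]"
  proof (rule nth_equalityI)
    show "length w = length (La # p @ [Lb])" using n2 unfolding p_def n_def by simp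
    fix i assume "i < length w"
    then consider "i = 0" | j where "i = Suc j" "j < n - 2" | "i = n - 1"
      unfolding n_def by (cases i) force+
    then show "w ! i = (La # p @ [Lb]) ! i"
    proof cases
      case 3 then show ?thesis using last n2 by (simp add: nth_append p_def nth_Cons' numeral_2_eq_2)
    qed (simp_all add: first p_def nth_append)
  qed
  moreover have "rev p = p"
  proof (rule nth_equalityI)
    fix i assume "i < length (rev p)"
    then have i: "i < n - 2" unfolding p_def by simp
    have "rev p ! i = p ! (n - 2 - Suc i)" using i unfolding p_def by (subst rev_nth) simp_all
    also have "\<dots> = w ! Suc (n - 2 - Suc i)" using i by (intro p_nth) simp
    also have "\<dots> = w ! (n - 1 - Suc i)" using i by (intro arg_cong[where f = "(!) w"]) simp
    also have "\<dots> = w ! Suc i" using i by (intro sym) simp_all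
    finally show "rev p ! i = p ! i" unfolding p_def using i by simp
  qed simp
  ultimately show ?thesis using that by blast
qed

section \<open>Cohn matrices: transposes, fixed points and traces\<close>

lemma matrix_mult_2:
  "((A :: real^2^2) ** B) $ i $ j = A $ i $ 1 * B $ 1 $ j + A $ i $ 2 * B $ 2 $ j"
  by (simp add: matrix_matrix_mult_def sum_2)

lemma cohn_letter_entries [simp]:
  "cohn_letter La $ 1 $ 1 = 3" "cohn_letter La $ 1 $ 2 = sqrt 2"
  "cohn_letter La $ 2 $ 1 = sqrt 2" "cohn_letter La $ 2 $ 2 = 1"
  "cohn_letter Lb $ 1 $ 1 = sqrt 2" "cohn_letter Lb $ 1 $ 2 = 1"
  "cohn_letter Lb $ 2 $ 1 = 1" "cohn_letter Lb $ 2 $ 2 = sqrt 2"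
  by (simp_all add: vector_2)

lemma cohn_append: "cohn (u @ v) = cohn u ** cohn v"
  by (induction u) (simp_all add: matrix_mul_assoc)

text \<open>Both generators are symmetric, so transposing a product only reverses its
  factors.\<close>

lemma cohn_rev: "cohn (rev w) = transpose (cohn w)"
proof (induction w)
  case (Cons l w)
  have "transpose (cohn_letter l) = cohn_letter l"
    by (cases l) (simp_all add: vec_eq_iff transpose_def forall_2)
  then show ?case using Cons by (simp add: cohn_append matrix_transpose_mul)
qed (simp add: transpose_mat)

lemma det_cohn: "det (cohn w) = 1"
proof (induction w)
  case (Cons l w)
  have "det (cohn_letter l) = 1" by (cases l) (simp_all add: det_2)
  then show ?case using Cons by (simp add: det_mul)
qed simp

lemma cohn_nonneg: "0 \<le> cohn w $ i $ j" "0 < cohn w $ 1 $ 1" "0 < cohn w $ 2 $ 2"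
proof -
  have "(\<forall>i j. 0 \<le> cohn w $ i $ j) \<and> 0 < cohn w $ 1 $ 1 \<and> 0 < cohn w $ 2 $ 2"
  proof (induction w)
    case Nil then show ?case by (simp add: mat_def)
  next
    case (Cons l w)
    then show ?case
      by (cases l) (simp_all add: forall_2 matrix_mult_2 add_nonneg_pos add_pos_nonneg)
  qed
  then show "0 \<le> cohn w $ i $ j" "0 < cohn w $ 1 $ 1" "0 < cohn w $ 2 $ 2" by auto
qed

lemma cohn_q_pos: "w \<noteq> [] \<Longrightarrow> 0 < cohn_q w"
proof (cases w)
  case (Cons l u)
  then show ?thesis unfolding cohn_q_def using cohn_nonneg[where w = u]
    by (cases l) (auto simp: matrix_mult_2 intro!: add_pos_nonneg)
qed simp

text \<open>\<open>cohn w\<close> acts on \<open>word_val X\<close> as a Moebius map with value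
  \<open>word_val (w @- X)\<close>; the cross-multiplied form is linear in the rows and needs no
  denominators in the induction.\<close>

lemma word_val_shift:
  "cohn w $ 1 $ 1 * word_val X + cohn w $ 1 $ 2 =
    word_val (w @- X) * (cohn w $ 2 $ 1 * word_val X + cohn w $ 2 $ 2)"
proof (induction w)
  case Nil then show ?case by (simp add: mat_def)
next
  case (Cons l w)
  define P Q v where "P = cohn w $ 1 $ 1 * word_val X + cohn w $ 1 $ 2"
    and "Q = cohn w $ 2 $ 1 * word_val X + cohn w $ 2 $ 2" and "v = word_val (w @- X)"
  have PQ: "P = v * Q" using Cons unfolding P_def Q_def v_def .
  have row: "cohn (l # w) $ i $ 1 * word_val X + cohn (l # w) $ i $ 2 =
      cohn_letter l $ i $ 1 * P + cohn_letter l $ i $ 2 * Q" for i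
    unfolding P_def Q_def by (simp add: matrix_mult_2 algebra_simps)
  have "0 \<le> v" unfolding v_def by (rule word_val_nonneg)
  then have "0 < sqrt 2 * v + 1" "0 < v + sqrt 2" by (simp_all add: add_nonneg_pos)
  then have "cohn_act l v * (cohn_letter l $ 2 $ 1 * v + cohn_letter l $ 2 $ 2) =
      cohn_letter l $ 1 $ 1 * v + cohn_letter l $ 1 $ 2"
    by (cases l) simp_all
  then have "cohn_letter l $ 1 $ 1 * P + cohn_letter l $ 1 $ 2 * Q =
      cohn_act l v * (cohn_letter l $ 2 $ 1 * P + cohn_letter l $ 2 $ 2 * Q)"
    unfolding PQ by (metis (no_types, opaque_lifting) distrib_right mult.assoc)
  then show ?case unfolding row by (simp add: word_val_SCons v_def)
qed

text \<open>For w = a p b with p a palindrome, \<open>cohn p\<close> is symmetric. If its entries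
  are x, y, y, z, then q = 2 x + 2 sqrt 2 y + z and the trace is 4 sqrt 2 x + 8 y + 2 sqrt 2
  z.\<close>

lemma trace_cohn_lower_christoffel:
  assumes "lower_christoffel w"
  shows "cohn w $ 1 $ 1 + cohn w $ 2 $ 2 = 2 * sqrt 2 * cohn_q w"
proof -
  have ss: "sqrt 2 * (sqrt 2 * z) = 2 * z" for z :: real by (simp add: mult.assoc[symmetric])
  have "w = [La] \<or> w = [Lb] \<or> (\<exists>p. w = La # p @ [Lb] \<and> rev p = p)"
    using assms unfolding lower_christoffel_def
  proof (elim disjE exE conjE)
    fix s t assume "0 < s" "0 < t" "coprime s t" "lower_christoffel_of_slope s t w"
    from lower_christoffel_palindrome[OF this] show ?thesis by blast
  qed blast+
  then consider "w = [La]" | "w = [Lb]" | p where "w = La # p @ [Lb]" "rev p = p" by blast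
  then show ?thesis
  proof cases
    case 3
    have "cohn p $ 1 $ 2 = cohn p $ 2 $ 1"
      using arg_cong[OF cohn_rev[of p], of "\<lambda>M. M $ 1 $ 2"] unfolding 3(2)
      by (simp only: transpose_def vec_lambda_beta)
    then show ?thesis unfolding 3(1) cohn_q_def
      by (simp add: cohn_append matrix_mult_2 algebra_simps ss)
  qed (simp_all add: cohn_q_def)
qed

text \<open>Let \<open>(p, r)\<close> and \<open>(q, s)\<close> be the rows of \<open>cohn w\<close>.  Since \<open>cohn (rev w)\<close> is the transpose,
  \<open>\<xi> = word_val (cycle w)\<close> and \<open>-1 / word_val (cycle (rev w))\<close> are the two roots of
  \<open>q x\<^sup>2 + (s - p) x - r\<close>, so the sum below is the square root of its discriminant divided by
  \<open>q\<close>.\<close>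
lemma word_val_cycle_sum:
  assumes w: "w \<noteq> []" and tr: "cohn w $ 1 $ 1 + cohn w $ 2 $ 2 = 2 * sqrt 2 * cohn_q w"
  shows "(1 / word_val (cycle (rev w)) + word_val (cycle w)) / sqrt 2 = sqrt (4 - 2 / (cohn_q w)\<^sup>2)"
proof -
  define p q r s where pqrs: "p = cohn w $ 1 $ 1" "q = cohn_q w" "r = cohn w $ 1 $ 2" "s = cohn w $ 2 $ 2"
  define \<xi> \<eta> \<zeta> where "\<xi> = word_val (cycle w)" and "\<eta> = word_val (cycle (rev w))" and "\<zeta> = 1 / \<eta>"
  have pos: "0 < \<xi>" "0 < \<eta>" unfolding \<xi>_def \<eta>_def by (simp_all add: word_val_bounds)
  have \<zeta>: "0 < \<zeta>" "\<eta> * \<zeta> = 1" unfolding \<zeta>_def using pos by simp_all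
  have q: "0 < q" unfolding pqrs by (rule cohn_q_pos[OF w])
  have det: "p * s - r * q = 1"
    using det_cohn[of w] unfolding det_2 pqrs cohn_q_def by simp
  have \<xi>: "p * \<xi> + r = \<xi> * (q * \<xi> + s)"
    using word_val_shift[of w "cycle w"] cycle_decomp[OF w] unfolding pqrs cohn_q_def \<xi>_def by simp
  have "p * \<eta> + q = \<eta> * (r * \<eta> + s)"
    using word_val_shift[of "rev w" "cycle (rev w)"] cycle_decomp[of "rev w"] w
    unfolding pqrs cohn_q_def \<eta>_def cohn_rev transpose_def by simp
  then have "(p * \<eta> + q) * \<zeta> * \<zeta> = \<eta> * (r * \<eta> + s) * \<zeta> * \<zeta>" by simp
  then have "p * (\<eta> * \<zeta>) * \<zeta> + q * \<zeta> * \<zeta> = r * (\<eta> * \<zeta>) * (\<eta> * \<zeta>) + s * (\<eta> * \<zeta>) * \<zeta>"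
    by (simp add: algebra_simps)
  then have \<zeta>_eq: "p * \<zeta> + q * \<zeta> * \<zeta> = r + s * \<zeta>" unfolding \<zeta> by simp
  \<comment> \<open>Adding the quadratic equations for \<xi> and -\<zeta> and cancelling \<xi> +
    \<zeta> gives Vieta's formula for the sum of the roots.\<close>
  have "(\<xi> + \<zeta>) * (q * (\<xi> - \<zeta>) - (p - s)) = 0" using \<xi> \<zeta>_eq by (simp add: algebra_simps)
  then have diff: "q * (\<xi> - \<zeta>) = p - s" using pos \<zeta> by simp
  have "q * \<xi> * \<xi> = (p - s) * \<xi> + r" using \<xi> by (simp add: algebra_simps)
  then have prod: "q * \<xi> * \<zeta> = r" unfolding diff[symmetric] by (simp add: algebra_simps)
  have "(q * (\<xi> + \<zeta>))\<^sup>2 = (q * (\<xi> - \<zeta>))\<^sup>2 + 4 * q * (q * \<xi> * \<zeta>)"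
    by (simp add: power2_eq_square algebra_simps)
  also have "\<dots> = (p + s)\<^sup>2 - 4 * (p * s - r * q)"
    unfolding diff prod by (simp add: power2_eq_square algebra_simps)
  also have "\<dots> = 8 * q\<^sup>2 - 4" using tr unfolding det pqrs[symmetric] by (simp add: power_mult_distrib)
  finally have "q\<^sup>2 * (\<xi> + \<zeta>)\<^sup>2 = 8 * q\<^sup>2 - 4" by (simp add: power_mult_distrib)
  then have "((\<xi> + \<zeta>) / sqrt 2)\<^sup>2 = 4 - 2 / q\<^sup>2" using q by (simp add: power_divide field_simps)
  moreover have "0 \<le> (\<xi> + \<zeta>) / sqrt 2" using pos \<zeta> by simp
  ultimately have "(\<xi> + \<zeta>) / sqrt 2 = sqrt (4 - 2 / q\<^sup>2)" by (metis real_sqrt_unique)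
  then show ?thesis unfolding \<zeta>_def \<xi>_def \<eta>_def pqrs by (simp add: add.commute)
qed

theorem theorem5p5:
  fixes w :: "ab list"
  assumes "lower_christoffel w"
  shows "L_biword (B_word w) = ereal (sqrt (4 - 2 / (cohn_q w)\<^sup>2))"
proof -
  \<comment> \<open>The trivial words satisfy the floor formula too, with t = 0 for a and t = 1 for
    b.\<close>
  have "w \<noteq> [] \<and> (\<exists>t. \<forall>k \<le> length w. count_list (take k w) Lb = k * t div length w)"
    using assms unfolding lower_christoffel_def
  proof (elim disjE exE conjE)
    assume "w = [La]"
    then show ?thesis by (intro conjI exI[of _ 0]) (auto simp: take_Cons')
  next
    assume "w = [Lb]"
    then show ?thesis by (intro conjI exI[of _ 1]) (auto simp: take_Cons')
  next
    fix s t assume st: "0 < s" "0 < t" "coprime s t" "lower_christoffel_of_slope s t w"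
    then have "w \<noteq> []" using lower_christoffel_prefix_count(1)[OF st] by auto
    then show ?thesis using lower_christoffel_prefix_count[OF st] by auto
  qed
  then obtain t where w: "w \<noteq> []"
    and cnt: "\<And>k. k \<le> length w \<Longrightarrow> count_list (take k w) Lb = k * t div length w"
    by blast
  have "L_biword (B_word w) = ereal ((1 / word_val (cycle (rev w)) + word_val (cycle w)) / sqrt 2)"
    using L_biword_extremal_section[OF word_val_periodic_extremal[OF w cnt]]
    unfolding right_word_periodic_word[OF w] left_word_periodic_word[OF w] B_word_def E_word_def by simp
  then show ?thesis using word_val_cycle_sum[OF w trace_cohn_lower_christoffel[OF assms]] by simp
qed

end
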